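(* Let $(G,Z)\neq(\{1\},\emptyset)$ and $n\ge1$. The space $X_n$ is aspherical, i.e. a $K(\pi,1)$ space.
   Context: $\mathbb P^1$ is the complex projective line with $\mathrm{PGL}(\mathbb C^2)$ acting by homographies. $G$ is a finite subgroup of $\mathrm{PGL}(\mathbb C^2)$ and $Z\subset\mathbb P^1$ is a finite $G$-stable set containing all points of $\mathbb P^1$ with non-trivial stabilizer in $G$. $X_n=\{(p_1,\dots,p_n)\in(\mathbb P^1\setminus Z)^n\mid p_i\ne g\cdot p_j\text{ for all }i\neq j,\ g\in G\}$. *)

theory Defs
  imports "HOL-Analysis.Analysis" "HOL-Algebra.Coset"
begin

section \<open>The complex projective line\<close>

definition quotient_topology :: "'a topology \<Rightarrow> ('a \<Rightarrow> 'b) \<Rightarrow> 'b topology" where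
  "quotient_topology X f =
     topology (\<lambda>U. U \<subseteq> f ` topspace X \<and> openin X {x \<in> topspace X. f x \<in> U})"

lemma openin_quotient_topology:
  "openin (quotient_topology X f) U \<longleftrightarrow>
     U \<subseteq> f ` topspace X \<and> openin X {x \<in> topspace X. f x \<in> U}"
proof -
  have "istopology (\<lambda>U. U \<subseteq> f ` topspace X \<and> openin X {x \<in> topspace X. f x \<in> U})"
    unfolding istopology_def
  proof (intro conjI allI impI)
    fix S T
    assume S: "S \<subseteq> f ` topspace X \<and> openin X {x \<in> topspace X. f x \<in> S}"
      and T: "T \<subseteq> f ` topspace X \<and> openin X {x \<in> topspace X. f x \<in> T}"
    have "{x \<in> topspace X. f x \<in> S \<inter> T} =
        {x \<in> topspace X. f x \<in> S} \<inter> {x \<in> topspace X. f x \<in> T}"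
      by auto
    then show "openin X {x \<in> topspace X. f x \<in> S \<inter> T}"
      using S T by auto
    show "S \<inter> T \<subseteq> f ` topspace X" using S by auto
  next
    fix K
    assume K: "\<forall>S\<in>K. S \<subseteq> f ` topspace X \<and> openin X {x \<in> topspace X. f x \<in> S}"
    have "{x \<in> topspace X. f x \<in> \<Union>K} = (\<Union>S\<in>K. {x \<in> topspace X. f x \<in> S})"
      by auto
    then show "openin X {x \<in> topspace X. f x \<in> \<Union>K}"
      using K by auto
    show "\<Union>K \<subseteq> f ` topspace X" using K by auto
  qed
  then show ?thesis
    by (simp add: quotient_topology_def topology_inverse')
qed

lemma topspace_quotient_topology: "topspace (quotient_topology X f) = f ` topspace X"
proof
  show "topspace (quotient_topology X f) \<subseteq> f ` topspace X"
    using openin_topspace[of "quotient_topology X f"] unfolding openin_quotient_topology by blast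
  have "{x \<in> topspace X. f x \<in> f ` topspace X} = topspace X" by auto
  then have "openin (quotient_topology X f) (f ` topspace X)"
    by (simp add: openin_quotient_topology)
  then show "f ` topspace X \<subseteq> topspace (quotient_topology X f)"
    by (rule openin_subset)
qed

lemma quotient_map_quotient_topology: "quotient_map X (quotient_topology X f) f"
  by (auto simp: quotient_map_def topspace_quotient_topology openin_quotient_topology)

text \<open>
  A point of the projective line is a complex line through the origin, taken as a set of vectors.
  The topology is the quotient topology of \<open>\<complex>\<^sup>2 - {0}\<close>.
\<close>

type_synonym line = "(complex ^ 2) set"

definition proj_line :: "line topology" where
  "proj_line = quotient_topology (top_of_set (UNIV - {0})) (\<lambda>v. vec.span {v})"

lemma topspace_proj_line: "topspace proj_line = {vec.span {v} | v. v \<noteq> 0}"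
  by (auto simp: proj_line_def topspace_quotient_topology)


section \<open>The projective linear group and its action by homographies\<close>

type_synonym mat2 = "complex ^ 2 ^ 2"

definition GL2 :: "mat2 monoid" where
  "GL2 = \<lparr>carrier = {A. invertible A}, mult = (**), one = mat 1\<rparr>"

definition scalars :: "mat2 set" where
  "scalars = {mat c | c. c \<noteq> 0}"

definition PGL2 :: "mat2 set monoid" where
  "PGL2 = GL2 Mod scalars"

lemma group_GL2: "group GL2"
proof (rule groupI)
  fix A assume "A \<in> carrier GL2"
  then obtain B where "A ** B = mat 1" "B ** A = mat 1"
    by (auto simp: GL2_def invertible_def)
  then show "\<exists>B\<in>carrier GL2. B \<otimes>\<^bsub>GL2\<^esub> A = \<one>\<^bsub>GL2\<^esub>"
    by (auto simp: GL2_def invertible_def)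
qed (auto simp: GL2_def invertible_mult matrix_mul_assoc, simp add: invertible_def)

lemma mat_matrix_mult: "mat c ** (A :: mat2) = (\<chi> i j. c * A $ i $ j)"
  by (simp add: matrix_matrix_mult_def mat_def vec_eq_iff sum_2 forall_2)

lemma matrix_mult_mat: "(A :: mat2) ** mat c = (\<chi> i j. c * A $ i $ j)"
  by (simp add: matrix_matrix_mult_def mat_def vec_eq_iff sum_2 forall_2)

lemma mat_mult_mat: "mat c ** mat d = (mat (c * d) :: mat2)"
  by (simp add: mat_matrix_mult) (simp add: mat_def vec_eq_iff)

lemma normal_scalars: "scalars \<lhd> GL2"
proof -
  interpret group GL2 by (rule group_GL2)
  have inv: "inv\<^bsub>GL2\<^esub> (mat c) = mat (1 / c)" if "c \<noteq> 0" for c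
    by (rule inv_equality)
      (use that in \<open>auto simp: GL2_def mat_mult_mat invertible_def
         intro: exI[of _ "mat c"] exI[of _ "mat (1 / c)"]\<close>)
  have sub: "subgroup scalars GL2"
  proof (rule subgroupI)
    show "scalars \<subseteq> carrier GL2"
    proof
      fix A :: mat2 assume "A \<in> scalars"
      then obtain c where "c \<noteq> 0" "A = mat c" by (auto simp: scalars_def)
      then show "A \<in> carrier GL2"
        by (auto simp: GL2_def mat_mult_mat invertible_def intro!: exI[of _ "mat (1 / c)"])
    qed
    show "scalars \<noteq> {}" by (auto simp: scalars_def intro: exI[of _ 1])
    show "inv\<^bsub>GL2\<^esub> A \<in> scalars" if "A \<in> scalars" for A
      using that inv by (fastforce simp: scalars_def)
    show "A \<otimes>\<^bsub>GL2\<^esub> B \<in> scalars" if "A \<in> scalars" "B \<in> scalars" for A B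
      using that by (fastforce simp: scalars_def GL2_def mat_mult_mat)
  qed
  show ?thesis
  proof (rule normalI[OF sub], rule ballI)
    fix A
    show "scalars #>\<^bsub>GL2\<^esub> A = A <#\<^bsub>GL2\<^esub> scalars"
      by (auto simp: r_coset_def l_coset_def scalars_def GL2_def mat_matrix_mult matrix_mult_mat)
  qed
qed

lemma group_PGL2: "group PGL2"
  unfolding PGL2_def by (rule normal.factorgroup_is_group[OF normal_scalars])

text \<open>
  An element of \<open>PGL2\<close> is the set of all nonzero multiples of an invertible matrix, so the union
  below is the image of the line under any one of these matrices.
\<close>

definition homography :: "mat2 set \<Rightarrow> line \<Rightarrow> line" where
  "homography g p = (\<Union>A\<in>g. (\<lambda>v. A *v v) ` p)"

lemma homography_coset:
  "homography (scalars #>\<^bsub>GL2\<^esub> A) (vec.span {v}) = vec.span {A *v v}"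
proof -
  have *: "(mat c ** A) *v (k *s v) = (c * k) *s (A *v v)" for c k :: complex
    by (simp add: mat_matrix_mult matrix_vector_mult_def vec_eq_iff sum_2 forall_2 algebra_simps)
  have "homography (scalars #>\<^bsub>GL2\<^esub> A) (vec.span {v}) =
      {(mat c ** A) *v (k *s v) | c k. c \<noteq> 0}"
    unfolding homography_def r_coset_def scalars_def GL2_def vec.span_singleton by auto
  also have "\<dots> = {(c * k) *s (A *v v) | c k. c \<noteq> 0}"
    by (simp only: *)
  also have "\<dots> = vec.span {A *v v}"
    by (auto simp: vec.span_singleton) (metis mult_1 zero_neq_one)
  finally show ?thesis .
qed


section \<open>The orbit configuration spaces\<close>

definition orbit_config :: "mat2 set set \<Rightarrow> line set \<Rightarrow> nat \<Rightarrow> (nat \<Rightarrow> line) topology" where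
  "orbit_config G Z n =
     subtopology (product_topology (\<lambda>_. subtopology proj_line (topspace proj_line - Z)) {1..n})
       {p. \<forall>i\<in>{1..n}. \<forall>j\<in>{1..n}. i \<noteq> j \<longrightarrow> (\<forall>g\<in>G. p i \<noteq> homography g (p j))}"


section \<open>Homotopy groups and aspherical spaces\<close>

definition cube :: "nat \<Rightarrow> (nat \<Rightarrow> real) topology" where
  "cube k = product_topology (\<lambda>_. top_of_set {0..1}) {..<k}"

definition cube_boundary :: "nat \<Rightarrow> (nat \<Rightarrow> real) set" where
  "cube_boundary k = {s \<in> topspace (cube k). \<exists>i<k. s i = 0 \<or> s i = 1}"

definition spheroids :: "nat \<Rightarrow> 'a topology \<Rightarrow> 'a \<Rightarrow> ((nat \<Rightarrow> real) \<Rightarrow> 'a) set" where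
  "spheroids k X x = {f. continuous_map (cube k) X f \<and> (\<forall>s\<in>cube_boundary k. f s = x)}"

text \<open>
  The underlying set of \<open>\<pi>\<^sub>k(X, x)\<close>: homotopy classes of maps \<open>(I\<^sup>k, \<partial>I\<^sup>k) \<rightarrow> (X, x)\<close>,
  where the homotopies send \<open>\<partial>I\<^sup>k\<close> to \<open>x\<close> at all times. The group structure is not needed to
  say that the group is trivial.
\<close>

definition homotopy_classes :: "nat \<Rightarrow> 'a topology \<Rightarrow> 'a \<Rightarrow> ((nat \<Rightarrow> real) \<Rightarrow> 'a) set set" where
  "homotopy_classes k X x =
     spheroids k X x //
       {(f, g). f \<in> spheroids k X x \<and> g \<in> spheroids k X x \<and>
          homotopic_with (\<lambda>h. \<forall>s\<in>cube_boundary k. h s = x) (cube k) X f g}"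

text \<open>
  A \<open>K(\<pi>, 1)\<close> space: nonempty, path connected, with trivial \<open>\<pi>\<^sub>k\<close> for all \<open>k \<ge> 2\<close>
  (the group \<open>\<pi>\<close> is then the fundamental group, on which there is no condition).
\<close>

definition aspherical_space :: "'a topology \<Rightarrow> bool" where
  "aspherical_space X \<longleftrightarrow>
     topspace X \<noteq> {} \<and> path_connected_space X \<and>
     (\<forall>k\<ge>2. \<forall>x\<in>topspace X. is_singleton (homotopy_classes k X x))"

end

theory Submission
  imports Defs "HOL-Complex_Analysis.Complex_Analysis"
begin

text \<open>
  Since \<open>Z\<close> is nonempty (a nontrivial homography has a fixed point), one of its points can be moved to
  infinity, and \<open>X\<^sub>n\<close> becomes an orbit configuration space in the plane. Forgetting the last point
  maps it to \<open>X\<^sub>n\<^sub>-\<^sub>1\<close>, with fibre the plane minus finitely many moving punctures. Homotopies lift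
  along this projection: in short time steps, the punctures drag the last point along by bump
  functions. It remains to contract spheres of dimension at least 2 in an open set \<open>U\<close> of
  the plane. Only finitely many small discs in \<open>U\<close> matter. If their union is not simply connected,
  it has a hole \<open>a\<close> without a branch of \<open>log (z - a)\<close>, and lifting the sphere and the discs
  along \<open>exp\<close> unglues two of the discs. After finitely many lifts the union is simply
  connected, hence homeomorphic to a disc.
\<close>

section \<open>Logarithms along homotopies\<close>

text \<open>The condition on \<open>(G, Z)\<close> excludes a single point moving on the whole
  sphere, which is not aspherical. The classical proof uses the long exact sequence of a fibration
  and the contractible universal cover of a plane domain; here both are replaced by explicit
  homotopies. Over the base, a contraction of the projected spheroid is lifted, and the lift must be
  constant on the boundary of the cube. This is why the lifting lemma also records that the last
  point rests wherever no puncture moves: bump functions multiplied by displacements of punctures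
  have this property. In the fibre, each lift through \<open>exp\<close> is a step towards the
  universal cover, and compactness of the cube bounds the number of steps. Dimension at least 2
  enters through the connectedness of the cube boundary: a lift of a map that is constant there is
  again constant there, whereas at the two ends of an interval it may differ by a period.\<close>

abbreviation cylinder :: "'a topology \<Rightarrow> (real \<times> 'a) topology" where
  "cylinder K \<equiv> prod_topology (top_of_set {0..1}) K"

section \<open>Continuity of maps from abstract topologies into type-class spaces\<close>

lemma continuous_map_compose_continuous_on:
  assumes "continuous_map X euclidean f" "continuous_on S h" "\<And>x. x \<in> topspace X \<Longrightarrow> f x \<in> S"
  shows "continuous_map X euclidean (\<lambda>x. h (f x))"
proof -
  have "continuous_map X (top_of_set S) f"
    using assms by (auto simp: continuous_map_in_subtopology)
  moreover have "continuous_map (top_of_set S) euclidean h"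
    using assms by simp
  ultimately show ?thesis
    using continuous_map_compose[of X "top_of_set S" f euclidean h] by (simp add: o_def)
qed

lemma continuous_map_euclidean_Pair:
  "continuous_map X euclidean f \<Longrightarrow> continuous_map X euclidean g \<Longrightarrow>
     continuous_map X euclidean (\<lambda>x. (f x, g x))"
  using continuous_map_pairedI[of X euclidean f euclidean g] by simp

lemma continuous_map_complex_mult:
  fixes f g :: "'a \<Rightarrow> complex"
  assumes "continuous_map X euclidean f" "continuous_map X euclidean g"
  shows "continuous_map X euclidean (\<lambda>x. f x * g x)"
proof -
  have "continuous_map X euclidean (\<lambda>x. (f x, g x))"
    using assms by (rule continuous_map_euclidean_Pair)
  from continuous_map_compose_continuous_on[OF this, where S=UNIV and h="\<lambda>z. fst z * snd z"]
  show ?thesis by (simp add: continuous_intros)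
qed

lemma continuous_map_complex_divide:
  fixes f g :: "'a \<Rightarrow> complex"
  assumes "continuous_map X euclidean f" "continuous_map X euclidean g"
    and "\<And>x. x \<in> topspace X \<Longrightarrow> g x \<noteq> 0"
  shows "continuous_map X euclidean (\<lambda>x. f x / g x)"
proof -
  have "continuous_map X euclidean (\<lambda>x. inverse (g x))"
    using assms by (intro continuous_map_compose_continuous_on[where S="-{0}" and h=inverse])
      (auto intro!: continuous_intros)
  from continuous_map_complex_mult[OF assms(1) this] show ?thesis
    by (simp add: field_simps)
qed

lemma continuous_map_complex_of_real:
  "continuous_map X euclideanreal f \<Longrightarrow> continuous_map X euclidean (\<lambda>x. complex_of_real (f x))"
  by (rule continuous_map_compose_continuous_on[where S=UNIV and h=complex_of_real])
    (auto intro!: continuous_intros)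

lemma continuous_map_slice:
  "continuous_map (cylinder K) Y F \<Longrightarrow> t \<in> {0..1} \<Longrightarrow> continuous_map K Y (\<lambda>s. F (t, s))"
  using continuous_map_o_Pair[of "top_of_set {0..1}" K Y F t] by (simp add: o_def)

text \<open>Applied to \<open>min t (i / N)\<close>, this freezes a homotopy from time
  \<open>i / N\<close> on.\<close>

lemma continuous_map_retime:
  assumes "continuous_map (cylinder K) Y F" "continuous_on {0..1} r" "r ` {0..1} \<subseteq> {0..1}"
  shows "continuous_map (cylinder K) Y (\<lambda>(t, s). F (r t, s))"
proof -
  have "continuous_map (cylinder K) (cylinder K) (\<lambda>x. (r (fst x), snd x))"
    using assms(2,3)
    by (intro continuous_map_pairedI continuous_map_snd
          continuous_map_compose[OF continuous_map_fst, unfolded o_def]) (auto simp: image_subset_iff)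
  from continuous_map_compose[OF this assms(1)] show ?thesis
    by (simp add: o_def case_prod_unfold)
qed

text \<open>\<open>K\<close> carries no metric, so uniform continuity is only available in time, at
  one point of \<open>K\<close> after another. Finitely many sample points suffice: every other
  point follows one of them closely at all times, and two such comparisons plus one time step cost
  \<open>e / 3\<close> each.\<close>

lemma uniform_in_time:
  fixes F :: "real \<times> 'a \<Rightarrow> 'b::metric_space"
  assumes K: "compact_space K" and F: "continuous_map (cylinder K) euclidean F" and "e > 0"
  obtains N :: nat where "N > 0"
    "\<And>s t t'. s \<in> topspace K \<Longrightarrow> t \<in> {0..1} \<Longrightarrow> t' \<in> {0..1} \<Longrightarrow> \<bar>t - t'\<bar> \<le> 1 / N
       \<Longrightarrow> dist (F (t, s)) (F (t', s)) < e"
proof -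
  define W where "W s = {s' \<in> topspace K. \<forall>t\<in>{0..1}. dist (F (t, s)) (F (t, s')) < e / 3}" for s
  have openW: "openin K (W s)" if s: "s \<in> topspace K" for s
  proof -
    \<comment> \<open>The tube lemma: projection along the compact time interval is a closed map, so
      the points that stray from \<open>s\<close> at some time form a closed set.\<close>
    define T where "T = {x \<in> topspace (cylinder K). dist (F (fst x, s)) (F x) \<in> {e / 3..}}"
    have "continuous_map (cylinder K) euclidean (\<lambda>x. F (fst x, s))"
      using continuous_map_compose[OF _ F, of "cylinder K" "\<lambda>x. (fst x, s)"] s
      by (simp add: o_def continuous_map_paired continuous_map_fst)
    then have "continuous_map (cylinder K) euclidean (\<lambda>x. (F (fst x, s), F x))"
      using F by (rule continuous_map_euclidean_Pair)
    from continuous_map_compose_continuous_on[OF this, where S=UNIV and h="\<lambda>z. dist (fst z) (snd z)"]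
    have "continuous_map (cylinder K) euclidean (\<lambda>x. dist (F (fst x, s)) (F x))"
      by (simp add: continuous_intros)
    then have "closedin (cylinder K) T"
      unfolding T_def by (rule closedin_continuous_map_preimage) simp
    moreover have "closed_map (cylinder K) K snd"
      by (intro closed_map_snd) (simp add: compact_space_subtopology)
    ultimately have "closedin K (snd ` T)" by (simp add: closed_map_def)
    moreover have "W s = topspace K - snd ` T"
      unfolding W_def T_def by (force simp: not_le)
    ultimately show ?thesis by (simp add: openin_diff)
  qed
  have "s \<in> W s" if "s \<in> topspace K" for s
    using that \<open>e > 0\<close> by (simp add: W_def)
  then have "topspace K \<subseteq> \<Union>(W ` topspace K)" by blast
  then obtain \<F> where "finite \<F>" "\<F> \<subseteq> W ` topspace K" "topspace K \<subseteq> \<Union>\<F>"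
    using K[unfolded compact_space_alt, rule_format, of "W ` topspace K"] openW by blast
  then obtain S where S: "finite S" "S \<subseteq> topspace K" "topspace K \<subseteq> \<Union>(W ` S)"
    using finite_subset_image[of \<F> W "topspace K"] by blast
  have "\<exists>d>0. \<forall>t\<in>{0..1}. \<forall>t'\<in>{0..1}. dist t' t < d \<longrightarrow> dist (F (t', s)) (F (t, s)) < e / 3"
    if "s \<in> S" for s
  proof -
    have "continuous_on {0..1} (\<lambda>t. F (t, s))"
      using continuous_map_compose[OF _ F, of "top_of_set {0..1}" "\<lambda>t. (t, s)"] S(2) that
      by (simp add: o_def continuous_map_paired subset_iff)
    then have "uniformly_continuous_on {0..1} (\<lambda>t. F (t, s))"
      by (rule compact_uniformly_continuous) simp
    moreover have "e / 3 > 0" using \<open>e > 0\<close> by simp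
    ultimately show ?thesis unfolding uniformly_continuous_on_def by meson
  qed
  then obtain d where d: "\<And>s. s \<in> S \<Longrightarrow> d s > 0"
    "\<And>s t t'. s \<in> S \<Longrightarrow> t \<in> {0..1} \<Longrightarrow> t' \<in> {0..1} \<Longrightarrow> dist t' t < d s \<Longrightarrow>
       dist (F (t', s)) (F (t, s)) < e / 3"
    by metis
  \<comment> \<open>The inserted \<open>1\<close> keeps the minimum defined when there are no sample
    points, that is, over an empty \<open>K\<close>.\<close>
  define m where "m = Min (insert 1 (d ` S))"
  have m: "m > 0" "\<And>s. s \<in> S \<Longrightarrow> m \<le> d s"
    using S(1) d(1) by (auto simp: m_def)
  obtain N :: nat where N: "N > 0" "1 / N < m"
    using m(1) by (metis nat_approx_posE zero_less_Suc)
  show ?thesis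
  proof (rule that[OF N(1)])
    fix s t t'
    assume st: "s \<in> topspace K" "t \<in> {0..1}" "t' \<in> {0..1::real}" "\<bar>t - t'\<bar> \<le> 1 / N"
    then obtain u where u: "u \<in> S" "s \<in> W u" using S(3) by blast
    have "dist t t' < d u" using st N m(2)[OF u(1)] by (simp add: dist_real_def)
    then have "dist (F (t, u)) (F (t', u)) < e / 3" using d(2) u st by blast
    moreover have "dist (F (t, u)) (F (t, s)) < e / 3" "dist (F (t', u)) (F (t', s)) < e / 3"
      using u(2) st by (auto simp: W_def)
    ultimately show "dist (F (t, s)) (F (t', s)) < e"
      using dist_triangle[of "F (t, s)" "F (t', s)" "F (t, u)"]
        dist_triangle[of "F (t, u)" "F (t', s)" "F (t', u)"]
      by (simp add: dist_commute)
  qed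
qed

lemma compact_space_cylinder: "compact_space K \<Longrightarrow> compact_space (cylinder K)"
  by (simp add: compact_space_prod_topology compact_space_subtopology)

lemma nonvanishing_bounded_below:
  fixes F :: "'a \<Rightarrow> 'b::real_normed_vector"
  assumes "compact_space X" and F: "continuous_map X euclidean F"
    and F0: "\<And>x. x \<in> topspace X \<Longrightarrow> F x \<noteq> 0"
  obtains e where "e > 0" "\<And>x. x \<in> topspace X \<Longrightarrow> e \<le> norm (F x)"
proof (cases "topspace X = {}")
  case True
  then show ?thesis using that[of 1] by simp
next
  case False
  have "continuous_map X euclidean (\<lambda>x. norm (F x))"
    using F by (rule continuous_map_norm)
  then have "compact ((\<lambda>x. norm (F x)) ` topspace X)"
    using assms(1) by (metis compact_space_def compactin_euclidean_iff image_compactin)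
  then obtain x where "x \<in> topspace X" "\<And>y. y \<in> topspace X \<Longrightarrow> norm (F x) \<le> norm (F y)"
    using False compact_attains_inf[of "(\<lambda>x. norm (F x)) ` topspace X"] by auto
  then show ?thesis using that[of "norm (F x)"] F0 by simp
qed

text \<open>Logarithms and punctures are both followed through copies of a homotopy stopped at time
  \<open>i / N\<close>. Consecutive copies look at times at most \<open>1 / N\<close> apart, so they
  are uniformly close.\<close>

lemma step_time:
  fixes t :: real
  assumes "N > 0" "t \<in> {0..1}"
  shows "min t (real i / real N) \<in> {0..1}"
    "\<bar>min t (real (Suc i) / real N) - min t (real i / real N)\<bar> \<le> 1 / real N"
proof -
  have min_diff: "\<bar>min t (a + d) - min t a\<bar> \<le> d" if "d \<ge> 0" for a d :: real
    using that by (auto simp: min_def)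
  have "real (Suc i) / N = real i / N + 1 / N" by (simp add: add_divide_distrib)
  then show "\<bar>min t (real (Suc i) / real N) - min t (real i / real N)\<bar> \<le> 1 / real N"
    using min_diff[of "1 / N"] by (simp del: of_nat_Suc)
qed (use assms in \<open>auto simp: min_le_iff_disj\<close>)

lemma continuous_on_Ln_ball: "continuous_on (ball 1 1) Ln"
proof (intro continuous_on_Ln)
  fix z :: complex assume "z \<in> ball 1 1"
  then have "\<bar>Re (1 - z)\<bar> < 1"
    using abs_Re_le_cmod[of "1 - z"] by (simp add: dist_norm)
  then show "z \<notin> \<real>\<^sub>\<le>\<^sub>0" by (auto simp: complex_nonpos_Reals_iff)
qed

text \<open>\<open>F\<close> is the telescoping product of its initial value and the quotients of
  consecutive stopped copies. Each quotient stays within distance 1 of the number 1, where the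
  principal branch \<open>Ln\<close> is continuous, so the logarithms of the factors can be added to
  \<open>l\<close>.\<close>

lemma logarithm_lift_homotopy:
  fixes F :: "real \<times> 'a \<Rightarrow> complex"
  assumes K: "compact_space K" and F: "continuous_map (cylinder K) euclidean F"
    and F0: "\<And>x. x \<in> topspace (cylinder K) \<Longrightarrow> F x \<noteq> 0"
    and l: "continuous_map K euclidean l" "\<And>s. s \<in> topspace K \<Longrightarrow> exp (l s) = F (0, s)"
  obtains L where "continuous_map (cylinder K) euclidean L"
    "\<And>x. x \<in> topspace (cylinder K) \<Longrightarrow> exp (L x) = F x"
proof -
  obtain e where e: "e > 0" "\<And>x. x \<in> topspace (cylinder K) \<Longrightarrow> e \<le> norm (F x)"
    using nonvanishing_bounded_below[OF compact_space_cylinder[OF K] F F0] by blast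
  \<comment> \<open>The lower bound \<open>e\<close> of the modulus doubles as the allowed variation
    in one step; this is what puts the quotients into \<open>ball 1 1\<close>.\<close>
  obtain N :: nat where N: "N > 0"
    "\<And>s t t'. s \<in> topspace K \<Longrightarrow> t \<in> {0..1} \<Longrightarrow> t' \<in> {0..1} \<Longrightarrow> \<bar>t - t'\<bar> \<le> 1 / N
       \<Longrightarrow> dist (F (t, s)) (F (t', s)) < e"
    using uniform_in_time[OF K F e(1)] by metis
  define r where "r i t = min t (real i / N)" for i t
  note r = step_time[OF \<open>N > 0\<close>, folded r_def]
  define G where "G i = (\<lambda>(t, s). F (r i t, s))" for i
  have G: "continuous_map (cylinder K) euclidean (G i)" for i
    unfolding G_def using r by (intro continuous_map_retime F) (auto simp: r_def intro!: continuous_intros)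
  have G0: "G i x \<noteq> 0" if "x \<in> topspace (cylinder K)" for i x
    using that F0 r by (auto simp: G_def)
  have ball: "G (Suc i) x / G i x \<in> ball 1 1" if x_in: "x \<in> topspace (cylinder K)" for i x
  proof -
    obtain t s where x: "x = (t, s)" "t \<in> {0..1}" "s \<in> topspace K"
      using x_in by auto
    have "dist (F (r (Suc i) t, s)) (F (r i t, s)) < e"
      using N(2)[OF x(3) r(1) r(1)] r(2) x by blast
    also have "e \<le> norm (F (r i t, s))" using e(2) r(1) x by simp
    finally have "norm (G i x - G (Suc i) x) < norm (G i x)"
      by (simp add: G_def x dist_norm norm_minus_commute)
    moreover have "1 - G (Suc i) x / G i x = (G i x - G (Suc i) x) / G i x"
      using G0[OF x_in] by (simp add: field_simps)
    ultimately show ?thesis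
      using G0[OF x_in] by (simp add: dist_norm norm_divide)
  qed
  define L where "L x = l (snd x) + (\<Sum>i<N. Ln (G (Suc i) x / G i x))" for x
  have "continuous_map (cylinder K) euclidean (\<lambda>x. Ln (G (Suc i) x / G i x))" for i
    using ball by (intro continuous_map_compose_continuous_on[OF _ continuous_on_Ln_ball]
        continuous_map_complex_divide G G0)
  then have "continuous_map (cylinder K) euclidean L"
    unfolding L_def
    by (intro continuous_map_add continuous_map_sum
          continuous_map_compose[OF continuous_map_snd l(1), unfolded o_def]) auto
  moreover have "exp (L x) = F x" if x: "x \<in> topspace (cylinder K)" for x
  proof -
    have "exp (l (snd x) + (\<Sum>i<n. Ln (G (Suc i) x / G i x))) = G n x" for n
    proof (induction n)
      case 0
      then show ?case using x l(2) by (auto simp: G_def r_def min_def)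
    next
      case (Suc n)
      have "exp (l (snd x) + (\<Sum>i<Suc n. Ln (G (Suc i) x / G i x)))
          = exp (l (snd x) + (\<Sum>i<n. Ln (G (Suc i) x / G i x))) * exp (Ln (G (Suc n) x / G n x))"
        by (simp add: exp_add)
      also have "\<dots> = G n x * (G (Suc n) x / G n x)"
        using Suc.IH G0[OF x] by simp
      finally show ?case using G0[OF x] by simp
    qed
    \<comment> \<open>Stopping at time \<open>N / N = 1\<close> changes nothing, so
      \<open>G N\<close> agrees with \<open>F\<close>.\<close>
    from this[of N] show ?thesis
      using x \<open>N > 0\<close> by (auto simp: L_def G_def r_def)
  qed
  ultimately show ?thesis using that by blast
qed

section \<open>Contracting maps into open subsets of the plane\<close>

lemma connected_continuous_map_image:
  "connected_space X \<Longrightarrow> continuous_map X euclidean f \<Longrightarrow> connected (f ` topspace X)"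
  using connectedin_continuous_map_image[of X euclidean f "topspace X"]
  by (simp add: connectedin_topspace)

lemma connected_space_top_of_set:
  assumes "connected S"
  shows "connected_space (top_of_set S)"
proof -
  have "connectedin euclidean S" using assms by simp
  then show ?thesis by (simp only: connectedin_def)
qed

text \<open>The difference takes values in the countable set of periods of \<open>exp\<close>, while
  a connected set of complex numbers with two points is uncountable.\<close>

lemma logarithms_differ_by_period:
  fixes l m :: "'a \<Rightarrow> complex"
  assumes "connected_space X" "continuous_map X euclidean l" "continuous_map X euclidean m"
    and "\<And>x. x \<in> topspace X \<Longrightarrow> exp (l x) = exp (m x)"
  obtains k where "exp k = 1" "\<And>x. x \<in> topspace X \<Longrightarrow> l x = m x + k"
proof (cases "topspace X = {}")
  case True
  then show ?thesis using that[of 0] by simp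
next
  case False
  define d where "d = (\<lambda>x. l x - m x)"
  have "continuous_map X euclidean d"
    unfolding d_def using assms by (intro continuous_map_diff)
  then have conn: "connected (d ` topspace X)"
    by (rule connected_continuous_map_image[OF assms(1)])
  have exp: "exp (d x) = 1" if "x \<in> topspace X" for x
    using assms(4)[OF that] by (simp add: d_def exp_diff)
  have "d ` topspace X \<subseteq> range (\<lambda>n::int. complex_of_real (of_int (2 * n) * pi) * \<i>)"
  proof
    fix w assume "w \<in> d ` topspace X"
    then obtain n :: int where "Re w = 0" "Im w = of_int (2 * n) * pi"
      using exp exp_eq_1 by fastforce
    then have "w = complex_of_real (of_int (2 * n) * pi) * \<i>"
      by (simp add: complex_eq_iff)
    then show "w \<in> range (\<lambda>n::int. complex_of_real (of_int (2 * n) * pi) * \<i>)" by blast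
  qed
  then have "countable (d ` topspace X)"
    by (rule countable_subset) simp
  then have "d x = d y" if "x \<in> topspace X" "y \<in> topspace X" for x y
    using conn connected_uncountable that by (metis imageI)
  then obtain k where k: "\<And>x. x \<in> topspace X \<Longrightarrow> d x = k" by blast
  show ?thesis
  proof (rule that)
    show "exp k = 1" using False exp k by blast
    show "l x = m x + k" if "x \<in> topspace X" for x
      using k[OF that] by (simp add: d_def algebra_simps)
  qed
qed

text \<open>A logarithm of \<open>z - a\<close>, being a function on \<open>S\<close>, lifts a
  closed path to a closed path in the plane. This lift contracts, and \<open>a + exp z\<close>
  carries the contraction to one that avoids \<open>a\<close>. So all winding numbers around points
  outside \<open>S\<close> vanish.\<close>

lemma simply_connected_if_logarithms:
  fixes S :: "complex set"
  assumes "open S" "connected S"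
    and log: "\<And>a. a \<notin> S \<Longrightarrow> \<exists>l. continuous_on S l \<and> (\<forall>z\<in>S. exp (l z) = z - a)"
  shows "simply_connected S"
  unfolding simply_connected_eq_winding_number_zero[OF \<open>open S\<close>]
proof (intro conjI allI impI assms(2))
  fix g a
  assume *: "path g \<and> path_image g \<subseteq> S \<and> pathfinish g = pathstart g \<and> a \<notin> S"
  then obtain l where l: "continuous_on S l" "\<And>z. z \<in> S \<Longrightarrow> exp (l z) = z - a"
    using log by blast
  define q where "q = l \<circ> g"
  have "path q" unfolding q_def
    using * l(1) by (intro path_continuous_image) (auto intro: continuous_on_subset)
  moreover have loop: "pathfinish q = pathstart q"
    using * by (simp add: q_def pathfinish_def pathstart_def)
  ultimately have "homotopic_loops UNIV q (linepath (q 0) (q 0))"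
    by (intro homotopic_loops_linear) auto
  then have "homotopic_loops (- {a}) ((\<lambda>z. a + exp z) \<circ> q) ((\<lambda>z. a + exp z) \<circ> linepath (q 0) (q 0))"
    by (rule homotopic_loops_continuous_image) (auto intro!: continuous_intros)
  moreover have "(\<lambda>z. a + exp z) \<circ> linepath (q 0) (q 0) = linepath (a + exp (q 0)) (a + exp (q 0))"
    by (simp add: fun_eq_iff linepath_refl)
  moreover have "homotopic_loops (- {a}) g ((\<lambda>z. a + exp z) \<circ> q)"
  proof (rule homotopic_loops_eq)
    show "path g" "path_image g \<subseteq> - {a}" "pathfinish g = pathstart g" using * by auto
    show "g t = ((\<lambda>z. a + exp z) \<circ> q) t" if "t \<in> {0..1}" for t
    proof -
      have "g t \<in> S" using * that by (auto simp: path_image_def)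
      then show ?thesis using l(2) by (simp add: q_def)
    qed
  qed
  ultimately have "homotopic_loops (- {a}) g (linepath (a + exp (q 0)) (a + exp (q 0)))"
    by (metis homotopic_loops_trans)
  then have "winding_number g a = winding_number (linepath (a + exp (q 0)) (a + exp (q 0))) a"
    by (rule winding_number_homotopic_loops)
  also have "\<dots> = 0" by simp
  finally show "winding_number g a = 0" .
qed

text \<open>In disc coordinates this is the straight-line homotopy to \<open>p b\<close>. It does
  not move points already at \<open>p b\<close>, which gives the condition on
  \<open>B\<close>.\<close>

lemma nullhomotopic_into_disc:
  fixes U :: "complex set"
  assumes U: "U homeomorphic ball (0::complex) 1"
    and f: "continuous_map K euclidean f" "f ` topspace K \<subseteq> U"
    and B: "\<And>s. s \<in> B \<Longrightarrow> f s = b" and "b \<in> U"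
  shows "\<exists>h. continuous_map (cylinder K) euclidean h \<and> h ` topspace (cylinder K) \<subseteq> U \<and>
           (\<forall>s\<in>topspace K. h (0, s) = f s \<and> h (1, s) = b) \<and> (\<forall>t\<in>{0..1}. \<forall>s\<in>B. h (t, s) = b)"
proof -
  obtain p q where "homeomorphism U (ball (0::complex) 1) p q" using U homeomorphic_def by blast
  then have p: "continuous_on U p" "p ` U = ball 0 1" and q: "continuous_on (ball 0 1) q" "q ` ball 0 1 = U"
    and qp: "\<And>z. z \<in> U \<Longrightarrow> q (p z) = z"
    by (auto simp: homeomorphism_def)
  define c where "c x = complex_of_real (1 - fst x) * p (f (snd x)) + complex_of_real (fst x) * p b" for x
  have "continuous_map K euclidean (\<lambda>s. p (f s))"
    using f by (intro continuous_map_compose_continuous_on[OF f(1) p(1)]) auto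
  then have pf: "continuous_map (cylinder K) euclidean (\<lambda>x. p (f (snd x)))"
    using continuous_map_compose[OF continuous_map_snd] by (simp add: o_def)
  have fst: "continuous_map (cylinder K) euclideanreal fst"
    by (rule continuous_map_into_fulltopology[OF continuous_map_fst])
  have c: "continuous_map (cylinder K) euclidean c"
    unfolding c_def
    by (intro continuous_map_add continuous_map_complex_mult continuous_map_complex_of_real pf fst
        continuous_map_diff) auto
  have cball: "c x \<in> ball 0 1" if "x \<in> topspace (cylinder K)" for x
  proof -
    have "f (snd x) \<in> U" using f(2) that by auto
    then have "p (f (snd x)) \<in> ball 0 1" "p b \<in> ball 0 1" using p(2) \<open>b \<in> U\<close> by blast+
    then have "(1 - fst x) *\<^sub>R p (f (snd x)) + fst x *\<^sub>R p b \<in> ball 0 1"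
      using that by (intro convexD[OF convex_ball]) auto
    then show ?thesis by (simp add: c_def scaleR_conv_of_real)
  qed
  have "continuous_map (cylinder K) euclidean (\<lambda>x. q (c x))"
    by (rule continuous_map_compose_continuous_on[OF c q(1) cball])
  moreover have "q (c x) \<in> U" if "x \<in> topspace (cylinder K)" for x
    using cball[OF that] q(2) by blast
  moreover have "c (t, s) = p b" if "s \<in> B" for t s
    using B[OF that] by (simp add: c_def algebra_simps)
  moreover have "q (c (0, s)) = f s" "q (c (1, s)) = b" if "s \<in> topspace K" for s
    using that qp f \<open>b \<in> U\<close> by (auto simp: c_def)
  ultimately show ?thesis
    using qp \<open>b \<in> U\<close> by (intro exI[of _ "\<lambda>x. q (c x)"]) auto
qed

text \<open>
  Induction on the number of overlapping pairs of patches. If the union of the patches has a hole at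
  \<open>a\<close>, lifting everything through \<open>exp\<close> along a logarithm of \<open>z - a\<close> separates at least one
  overlapping pair, as otherwise the branches of the logarithm would glue; so the process stops at
  a simply connected union.
\<close>

lemma nullhomotopic_in_patches:
  fixes K :: "'a topology" and f :: "'a \<Rightarrow> complex" and D :: "'i \<Rightarrow> complex set"
  assumes K: "connected_space K"
    and log: "\<And>g :: 'a \<Rightarrow> complex. continuous_map K euclidean g \<Longrightarrow> (\<And>s. s \<in> topspace K \<Longrightarrow> g s \<noteq> 0)
        \<Longrightarrow> \<exists>l. continuous_map K euclidean l \<and> (\<forall>s\<in>topspace K. exp (l s) = g s)"
    and B: "connectedin K B" "B \<noteq> {}"
    and I: "finite I"
    and E: "\<And>i. i \<in> I \<Longrightarrow> connectedin K (E i)" "\<And>i. i \<in> I \<Longrightarrow> E i \<noteq> {}" "topspace K = \<Union>(E ` I)"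
    and "continuous_map K euclidean f"
    and "\<And>i. i \<in> I \<Longrightarrow> open (D i)" "\<And>i. i \<in> I \<Longrightarrow> simply_connected (D i)"
    and "\<And>i j. i \<in> I \<Longrightarrow> j \<in> I \<Longrightarrow> connected (D i \<inter> D j)"
    and "\<And>i. i \<in> I \<Longrightarrow> f ` E i \<subseteq> D i"
    and "\<And>s. s \<in> B \<Longrightarrow> f s = b"
  shows "\<exists>h. continuous_map (cylinder K) euclidean h \<and> h ` topspace (cylinder K) \<subseteq> \<Union>(D ` I) \<and>
           (\<forall>s\<in>topspace K. h (0, s) = f s \<and> h (1, s) = b) \<and> (\<forall>t\<in>{0..1}. \<forall>s\<in>B. h (t, s) = b)"
  using assms(9-14)
proof (induction "card {(i, j) \<in> I \<times> I. D i \<inter> D j \<noteq> {}}" arbitrary: f D b rule: less_induct)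
  case less
  note f = less.prems(1) and D = less.prems(2-4) and fE = less.prems(5) and fB = less.prems(6)
  define U where "U = \<Union>(D ` I)"
  have BK: "B \<subseteq> topspace K" using B(1) connectedin_subset_topspace by blast
  obtain s0 where s0: "s0 \<in> B" "s0 \<in> topspace K" using B(2) BK by blast
  have fU: "f ` topspace K \<subseteq> U" using fE E(3) by (fastforce simp: U_def)
  have "open U" using D(1) by (auto simp: U_def)
  have "b \<in> U" using s0 fU fB by blast
  have "connected (f ` topspace K)"
    by (rule connected_continuous_map_image[OF K f])
  then have "connected (f ` topspace K \<union> D i)" if i: "i \<in> I" for i
  proof -
    obtain s where "s \<in> E i" using E(2)[OF i] by blast
    then have "f s \<in> f ` topspace K \<inter> D i" using E(3) fE[OF i] i by blast
    then have "f ` topspace K \<inter> D i \<noteq> {}" by blast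
    with \<open>connected (f ` topspace K)\<close> show ?thesis
      using simply_connected_imp_connected[OF D(2)[OF i]] by (intro connected_Un)
  qed
  then have "connected (\<Union>i\<in>I. f ` topspace K \<union> D i)"
    using s0 by (intro connected_Union) auto
  moreover have "(\<Union>i\<in>I. f ` topspace K \<union> D i) = U"
    using fU s0 E(3) by (auto simp: U_def)
  ultimately have "connected U" by simp
  show ?case
  proof (cases "simply_connected U")
    case True
    \<comment> \<open>The Riemann mapping theorem; as a homeomorphism suffices, the whole plane is
      no exception.\<close>
    then have "U homeomorphic ball (0::complex) 1"
      using simply_connected_eq_homeomorphic_to_disc[OF \<open>open U\<close>] \<open>b \<in> U\<close> by blast
    from nullhomotopic_into_disc[OF this f fU fB \<open>b \<in> U\<close>] show ?thesis
      unfolding U_def by blast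
  next
    case False
    then obtain a where a: "a \<notin> U" and nolog: "\<not> (\<exists>l. continuous_on U l \<and> (\<forall>z\<in>U. exp (l z) = z - a))"
      using simply_connected_if_logarithms[OF \<open>open U\<close> \<open>connected U\<close>] by blast
    obtain f' where f': "continuous_map K euclidean f'" "\<And>s. s \<in> topspace K \<Longrightarrow> exp (f' s) = f s - a"
      using log[of "\<lambda>s. f s - a"] f fU a by (fastforce intro: continuous_map_diff)
    \<comment> \<open>A branch of the logarithm exists on the simply connected \<open>D i\<close>.
      Since \<open>E i\<close> is connected, adding one period makes it agree with \<open>f'\<close>
      along \<open>f\<close>, so that the lifted patches again receive the lifted map.\<close>
    have "\<exists>l. continuous_on (D i) l \<and> (\<forall>z\<in>D i. exp (l z) = z - a) \<and> (\<forall>s\<in>E i. l (f s) = f' s)"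
      if i: "i \<in> I" for i
    proof -
      have EK: "E i \<subseteq> topspace K" using E(3) i by blast
      obtain l where l: "continuous_on (D i) l" "\<And>z. z \<in> D i \<Longrightarrow> z - a = exp (l z)"
      proof (rule continuous_logarithm_on_simply_connected[of "D i" "\<lambda>z. z - a"])
        show "locally path_connected (D i)" using D(1) i open_imp_locally_path_connected by blast
        show "z - a \<noteq> 0" if "z \<in> D i" for z using that a i by (auto simp: U_def)
      qed (use D(2) i in \<open>auto intro!: continuous_intros\<close>)
      have fKE: "continuous_map (subtopology K (E i)) euclidean f"
        "continuous_map (subtopology K (E i)) euclidean f'"
        using f f'(1) by (auto intro: continuous_map_from_subtopology)
      have 1: "connected_space (subtopology K (E i))"
        using E(1)[OF i] by (simp add: connectedin_def)
      have 2: "continuous_map (subtopology K (E i)) euclidean (\<lambda>s. l (f s))"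
        using fE[OF i] by (intro continuous_map_compose_continuous_on[OF fKE(1) l(1)]) auto
      have 3: "exp (f' s) = exp (l (f s))" if "s \<in> topspace (subtopology K (E i))" for s
        using that f'(2) l(2) fE[OF i] by auto
      obtain k where k: "exp k = 1" "\<And>s. s \<in> topspace (subtopology K (E i)) \<Longrightarrow> f' s = l (f s) + k"
        using logarithms_differ_by_period[OF 1 fKE(2) 2 3] by blast
      show ?thesis
      proof (intro exI conjI ballI)
        show "continuous_on (D i) (\<lambda>z. l z + k)" by (intro continuous_intros l(1))
        show "exp (l z + k) = z - a" if "z \<in> D i" for z
          using l(2)[OF that] k(1) by (simp add: exp_add)
        show "l (f s) + k = f' s" if "s \<in> E i" for s
          using k(2)[of s] that EK by auto
      qed
    qed
    then obtain l where l: "\<And>i. i \<in> I \<Longrightarrow> continuous_on (D i) (l i)"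
      "\<And>i z. i \<in> I \<Longrightarrow> z \<in> D i \<Longrightarrow> exp (l i z) = z - a"
      "\<And>i s. i \<in> I \<Longrightarrow> s \<in> E i \<Longrightarrow> l i (f s) = f' s"
      by metis
    define D' where "D' i = l i ` D i" for i
    \<comment> \<open>\<open>exp\<close> recovers \<open>z - a\<close> from the value of any branch,
      so lifted patches can meet only over a common point of the old ones.\<close>
    have inj: "z = w" if "i \<in> I" "j \<in> I" "z \<in> D i" "w \<in> D j" "l i z = l j w" for i j z w
      using l(2)[OF that(1,3)] l(2)[OF that(2,4)] that(5) by simp
    \<comment> \<open>A pair of patches that still overlaps has branches agreeing at one point,
      hence on the whole connected intersection. Its new intersection is then a homeomorphic copy of
      the old one and the hypotheses persist.\<close>
    have agree: "l i z = l j z"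
      if ij: "i \<in> I" "j \<in> I" "D' i \<inter> D' j \<noteq> {}" "z \<in> D i \<inter> D j" for i j z
    proof -
      obtain w where w: "w \<in> D i \<inter> D j" "l i w = l j w"
        using ij inj[of i j] by (force simp: D'_def)
      have 1: "connected_space (top_of_set (D i \<inter> D j))"
        using D(3)[OF ij(1,2)] by (rule connected_space_top_of_set)
      have 2: "continuous_map (top_of_set (D i \<inter> D j)) euclidean (l i)"
        "continuous_map (top_of_set (D i \<inter> D j)) euclidean (l j)"
        using l(1)[OF ij(1)] l(1)[OF ij(2)] by (auto intro: continuous_on_subset)
      obtain k where k: "\<And>z. z \<in> topspace (top_of_set (D i \<inter> D j)) \<Longrightarrow> l i z = l j z + k"
        by (rule logarithms_differ_by_period[OF 1 2]) (use l(2) ij in auto)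
      from k[of w] w k[of z] ij(4) show ?thesis by simp
    qed
    have D'int: "D' i \<inter> D' j = l i ` (D i \<inter> D j)" if "i \<in> I" "j \<in> I" "D' i \<inter> D' j \<noteq> {}" for i j
      using agree[OF that] inj[OF that(1,2)] by (force simp: D'_def)
    define P where "P = {(i, j) \<in> I \<times> I. D i \<inter> D j \<noteq> {}}"
    define P' where "P' = {(i, j) \<in> I \<times> I. D' i \<inter> D' j \<noteq> {}}"
    have "P' \<subseteq> P" using D'int by (fastforce simp: P_def P'_def)
    moreover have "P' \<noteq> P"
    proof
      assume PP: "P' = P"
      have glue: "l i z = l j z" if "i \<in> I" "j \<in> I" "z \<in> D i" "z \<in> D j" for i j z
      proof -
        have "(i, j) \<in> P" using that by (auto simp: P_def)
        then have "D' i \<inter> D' j \<noteq> {}" unfolding PP[symmetric] P'_def by simp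
        from agree[OF that(1,2) this, of z] that(3,4) show ?thesis by simp
      qed
      define L where "L z = l (SOME i. i \<in> I \<and> z \<in> D i) z" for z
      have L: "L z = l i z" if "i \<in> I" "z \<in> D i" for i z
      proof -
        define j where "j = (SOME i. i \<in> I \<and> z \<in> D i)"
        have "j \<in> I \<and> z \<in> D j"
          unfolding j_def by (rule someI[of _ i]) (use that in simp)
        with glue[of j i z] that show ?thesis by (simp add: L_def j_def)
      qed
      have "continuous_on (D i) L" if "i \<in> I" for i
        using l(1)[OF that] by (rule continuous_on_eq) (simp add: L[OF that])
      then have "continuous_on U L"
        unfolding U_def using D(1) by (intro continuous_on_open_UN) auto
      moreover have "exp (L z) = z - a" if "z \<in> U" for z
        using that L l(2) by (auto simp: U_def)
      ultimately show False using nolog by blast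
    qed
    moreover have "finite P"
      by (rule finite_subset[of _ "I \<times> I"]) (use I in \<open>auto simp: P_def\<close>)
    ultimately have card: "card P' < card P" by (intro psubset_card_mono psubsetI)
    have l_inj: "inj_on (l i) (D i)" if "i \<in> I" for i
      by (rule inj_onI) (rule inj[OF that that])
    \<comment> \<open>Invariance of domain: an injective branch preserves openness and simple
      connectivity of the patch.\<close>
    have hom: "D i homeomorphic D' i" if "i \<in> I" for i
      unfolding D'_def
      by (rule invariance_of_domain_homeomorphic[OF D(1) l(1) _ l_inj]) (use that in auto)
    \<comment> \<open>On \<open>B\<close> the lift is a logarithm of the constant
      \<open>b - a\<close>; connectedness of \<open>B\<close> prevents it from jumping by a
      period.\<close>
    have fconst: "f' s = f' s0" if "s \<in> B" for s
    proof -
      have 1: "connected_space (subtopology K B)"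
        using B(1) by (simp add: connectedin_def)
      have 2: "continuous_map (subtopology K B) euclidean f'"
        "continuous_map (subtopology K B) euclidean (\<lambda>_. f' s0)"
        using f'(1) by (auto intro: continuous_map_from_subtopology)
      have 3: "exp (f' s) = exp (f' s0)" if "s \<in> topspace (subtopology K B)" for s
        using that by (simp add: f'(2) fB s0)
      obtain k where k: "\<And>s. s \<in> topspace (subtopology K B) \<Longrightarrow> f' s = f' s0 + k"
        using logarithms_differ_by_period[OF 1 2 3] by blast
      from k[of s] k[of s0] that s0 BK show ?thesis by auto
    qed
    have "\<exists>h. continuous_map (cylinder K) euclidean h \<and> h ` topspace (cylinder K) \<subseteq> \<Union>(D' ` I) \<and>
           (\<forall>s\<in>topspace K. h (0, s) = f' s \<and> h (1, s) = f' s0) \<and> (\<forall>t\<in>{0..1}. \<forall>s\<in>B. h (t, s) = f' s0)"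
    proof (rule less.hyps)
      show "card {(i, j) \<in> I \<times> I. D' i \<inter> D' j \<noteq> {}} < card {(i, j) \<in> I \<times> I. D i \<inter> D j \<noteq> {}}"
        using card by (simp add: P_def P'_def)
      show "continuous_map K euclidean f'" by fact
      fix i assume i: "i \<in> I"
      show "open (D' i)"
        unfolding D'_def by (rule invariance_of_domain[OF l(1) D(1) l_inj]) (use i in auto)
      show "simply_connected (D' i)"
        by (rule homeomorphic_simply_connected[OF hom[OF i] D(2)[OF i]])
      show "f' ` E i \<subseteq> D' i"
        using l(3)[OF i] fE[OF i] by (force simp: D'_def)
      fix j assume j: "j \<in> I"
      show "connected (D' i \<inter> D' j)"
      proof (cases "D' i \<inter> D' j = {}")
        case False
        have "continuous_on (D i \<inter> D j) (l i)" using l(1)[OF i] by (rule continuous_on_subset) simp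
        with D(3)[OF i j] show ?thesis
          unfolding D'int[OF i j False] by (intro connected_continuous_image)
      qed simp
    next
      show "f' s = f' s0" if "s \<in> B" for s using fconst that by blast
    qed
    then obtain h where h: "continuous_map (cylinder K) euclidean h"
      "h ` topspace (cylinder K) \<subseteq> \<Union>(D' ` I)"
      "\<And>s. s \<in> topspace K \<Longrightarrow> h (0, s) = f' s" "\<And>s. s \<in> topspace K \<Longrightarrow> h (1, s) = f' s0"
      "\<And>t s. t \<in> {0..1} \<Longrightarrow> s \<in> B \<Longrightarrow> h (t, s) = f' s0"
      by blast
    have b: "a + exp (f' s0) = b" using f'(2) fB s0 by simp
    show ?thesis
    proof (intro exI[of _ "\<lambda>x. a + exp (h x)"] conjI ballI)
      show "continuous_map (cylinder K) euclidean (\<lambda>x. a + exp (h x))"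
        by (rule continuous_map_compose_continuous_on[OF h(1), where S=UNIV and h="\<lambda>z. a + exp z"])
          (auto intro!: continuous_intros)
      show "(\<lambda>x. a + exp (h x)) ` topspace (cylinder K) \<subseteq> \<Union>(D ` I)"
      proof
        fix w assume "w \<in> (\<lambda>x. a + exp (h x)) ` topspace (cylinder K)"
        then obtain x where x: "x \<in> topspace (cylinder K)" "w = a + exp (h x)" by blast
        then obtain i z where "i \<in> I" "z \<in> D i" "h x = l i z"
          using h(2) unfolding D'_def by blast
        then show "w \<in> \<Union>(D ` I)" using x l(2) by auto
      qed
    qed (use h f'(2) b in auto)
  qed
qed

section \<open>Moving punctures\<close>

text \<open>The bump functions are tents of height 1 and radius \<open>\<delta> / 2\<close>, hence
  of slope \<open>2 / \<delta>\<close>. The tents of punctures at mutual distance at least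
  \<open>\<delta>\<close> vanish at each other's centres.\<close>

lemma tent_lipschitz:
  fixes z w q :: complex and \<delta> :: real
  assumes "\<delta> > 0"
  shows "\<bar>max 0 (1 - 2 * norm (z - q) / \<delta>) - max 0 (1 - 2 * norm (w - q) / \<delta>)\<bar> \<le> 2 * norm (z - w) / \<delta>"
proof -
  have "\<bar>norm (z - q) - norm (w - q)\<bar> \<le> norm (z - w)"
    using norm_triangle_ineq3[of "z - q" "w - q"] by simp
  then have "\<bar>2 * norm (z - q) / \<delta> - 2 * norm (w - q) / \<delta>\<bar> \<le> 2 * norm (z - w) / \<delta>"
    using assms by (simp add: abs_le_iff field_simps)
  then show ?thesis by linarith
qed

text \<open>
  The map \<open>z \<mapsto> z + \<Sum>\<^sub>i \<beta>\<^sub>i(z) (q'\<^sub>i - q\<^sub>i)\<close> is a contractive perturbation of the identity,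
  hence injective, and it sends each \<open>q\<^sub>k\<close> to \<open>q'\<^sub>k\<close>.
\<close>

lemma push_avoids:
  fixes q q' :: "'i \<Rightarrow> complex" and \<delta> \<epsilon> :: real
  assumes "finite L" "\<delta> > 0"
    and sep: "\<And>i j. i \<in> L \<Longrightarrow> j \<in> L \<Longrightarrow> i \<noteq> j \<Longrightarrow> \<delta> \<le> norm (q i - q j)"
    and small: "\<And>i. i \<in> L \<Longrightarrow> norm (q' i - q i) \<le> \<epsilon>" and \<epsilon>: "2 * card L * \<epsilon> < \<delta>"
    and "k \<in> L" "z \<noteq> q k"
  shows "z + (\<Sum>i\<in>L. of_real (max 0 (1 - 2 * norm (z - q i) / \<delta>)) * (q' i - q i)) \<noteq> q' k"
proof
  define \<beta> where "\<beta> w i = max 0 (1 - 2 * norm (w - q i) / \<delta>)" for w i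
  assume "z + (\<Sum>i\<in>L. of_real (max 0 (1 - 2 * norm (z - q i) / \<delta>)) * (q' i - q i)) = q' k"
  then have z: "z + (\<Sum>i\<in>L. of_real (\<beta> z i) * (q' i - q i)) = q' k" by (simp add: \<beta>_def)
  \<comment> \<open>At \<open>q k\<close> only the tent of index \<open>k\<close> is nonzero, and it
    equals 1. Hence the push sends \<open>q k\<close> to \<open>q' k\<close>.\<close>
  have "\<beta> (q k) i = (if i = k then 1 else 0)" if "i \<in> L" for i
    using sep[of k i] that \<open>k \<in> L\<close> \<open>\<delta> > 0\<close> by (auto simp: \<beta>_def field_simps max_def)
  then have "(\<Sum>i\<in>L. of_real (\<beta> (q k) i) * (q' i - q i)) = (\<Sum>i\<in>L. if i = k then q' i - q i else 0)"
    by (intro sum.cong) auto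
  then have "(\<Sum>i\<in>L. of_real (\<beta> (q k) i) * (q' i - q i)) = q' k - q k"
    using \<open>k \<in> L\<close> \<open>finite L\<close> by simp
  \<comment> \<open>Two points with the same image differ by the difference of their displacements.
    The displacement has Lipschitz constant at most
    \<open>2 * card L * \<epsilon> / \<delta>\<close>, which is less than 1, so the points
    coincide.\<close>
  with z have "q k - z = (\<Sum>i\<in>L. of_real (\<beta> z i) * (q' i - q i)) - (\<Sum>i\<in>L. of_real (\<beta> (q k) i) * (q' i - q i))"
    by (simp add: algebra_simps)
  also have "\<dots> = (\<Sum>i\<in>L. of_real (\<beta> z i - \<beta> (q k) i) * (q' i - q i))"
    by (simp add: sum_subtractf left_diff_distrib)
  also have "norm \<dots> \<le> (\<Sum>i\<in>L. 2 * norm (z - q k) / \<delta> * \<epsilon>)"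
  proof (rule sum_norm_le)
    fix i assume i: "i \<in> L"
    have "norm (of_real (\<beta> z i - \<beta> (q k) i) * (q' i - q i)) = \<bar>\<beta> z i - \<beta> (q k) i\<bar> * norm (q' i - q i)"
      by (simp only: norm_mult norm_of_real)
    also have "\<dots> \<le> 2 * norm (z - q k) / \<delta> * \<epsilon>"
      using tent_lipschitz[OF \<open>\<delta> > 0\<close>, of z "q i" "q k"] small[OF i]
      unfolding \<beta>_def by (intro mult_mono) (use \<open>\<delta> > 0\<close> in auto)
    finally show "norm (of_real (\<beta> z i - \<beta> (q k) i) * (q' i - q i)) \<le> 2 * norm (z - q k) / \<delta> * \<epsilon>" .
  qed
  also have "\<dots> = (2 * card L * \<epsilon>) / \<delta> * norm (z - q k)" by simp
  also have "\<dots> < 1 * norm (z - q k)"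
    using \<epsilon> \<open>\<delta> > 0\<close> \<open>z \<noteq> q k\<close> by (intro mult_strict_right_mono) auto
  finally show False by (simp add: norm_minus_commute)
qed

text \<open>The last clause is what later makes lifts relative to the cube boundary: over a point
  \<open>s\<close> where all punctures rest, every displacement is zero and the pushed point rests
  too.\<close>

lemma moving_punctures_lift:
  fixes q :: "'i \<Rightarrow> real \<times> 'a \<Rightarrow> complex"
  assumes K: "compact_space K" and L: "finite L"
    and q: "\<And>i. i \<in> L \<Longrightarrow> continuous_map (cylinder K) euclidean (q i)"
    and distinct: "\<And>i j x. i \<in> L \<Longrightarrow> j \<in> L \<Longrightarrow> i \<noteq> j \<Longrightarrow> x \<in> topspace (cylinder K) \<Longrightarrow> q i x \<noteq> q j x"
    and h0: "continuous_map K euclidean h0"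
    and avoid: "\<And>i s. i \<in> L \<Longrightarrow> s \<in> topspace K \<Longrightarrow> h0 s \<noteq> q i (0, s)"
  obtains h where "continuous_map (cylinder K) euclidean h"
    "\<And>s. s \<in> topspace K \<Longrightarrow> h (0, s) = h0 s"
    "\<And>i x. i \<in> L \<Longrightarrow> x \<in> topspace (cylinder K) \<Longrightarrow> h x \<noteq> q i x"
    "\<And>s t. s \<in> topspace K \<Longrightarrow> t \<in> {0..1} \<Longrightarrow> \<forall>i\<in>L. \<forall>t\<in>{0..1}. q i (t, s) = q i (0, s)
       \<Longrightarrow> h (t, s) = h0 s"
proof -
  define P where "P = {(i, j) \<in> L \<times> L. i \<noteq> j}"
  have "finite P" by (rule finite_subset[of _ "L \<times> L"]) (use L in \<open>auto simp: P_def\<close>)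
  have "\<exists>e>0. \<forall>x\<in>topspace (cylinder K). e \<le> norm (q (fst p) x - q (snd p) x)" if "p \<in> P" for p
  proof -
    have "fst p \<in> L" "snd p \<in> L" "fst p \<noteq> snd p" using that by (auto simp: P_def)
    then have "continuous_map (cylinder K) euclidean (\<lambda>x. q (fst p) x - q (snd p) x)"
      "\<And>x. x \<in> topspace (cylinder K) \<Longrightarrow> q (fst p) x - q (snd p) x \<noteq> 0"
      using distinct q by (auto intro: continuous_map_diff)
    then show ?thesis
      by (rule nonvanishing_bounded_below[OF compact_space_cylinder[OF K]]) (assumption, blast)
  qed
  then obtain e where e: "\<And>p. p \<in> P \<Longrightarrow> e p > 0"
    "\<And>p x. p \<in> P \<Longrightarrow> x \<in> topspace (cylinder K) \<Longrightarrow> e p \<le> norm (q (fst p) x - q (snd p) x)"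
    by metis
  \<comment> \<open>A uniform separation of the punctures over the whole cylinder; the inserted
    \<open>1\<close> covers the case of at most one puncture.\<close>
  define \<delta> where "\<delta> = Min (insert 1 (e ` P))"
  have "\<delta> > 0" using e(1) \<open>finite P\<close> by (auto simp: \<delta>_def)
  have sep: "\<delta> \<le> norm (q i x - q j x)" if "i \<in> L" "j \<in> L" "i \<noteq> j" "x \<in> topspace (cylinder K)" for i j x
  proof -
    have "(i, j) \<in> P" using that by (simp add: P_def)
    then have "\<delta> \<le> e (i, j)" using \<open>finite P\<close> by (simp add: \<delta>_def)
    with e(2)[OF \<open>(i, j) \<in> P\<close> that(4)] show ?thesis by simp
  qed
  \<comment> \<open>The bound on one step that makes a push a contractive perturbation; the
    \<open>+ 1\<close> makes the inequality strict and covers an empty \<open>L\<close>.\<close>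
  define \<epsilon> where "\<epsilon> = \<delta> / (2 * card L + 1)"
  have "\<epsilon> > 0" "2 * card L * \<epsilon> < \<delta>"
    using \<open>\<delta> > 0\<close> by (auto simp: \<epsilon>_def field_simps)
  have "\<exists>N. (0::nat) < N \<and> (\<forall>s\<in>topspace K. \<forall>t\<in>{0..1}. \<forall>t'\<in>{0..1}. \<bar>t - t'\<bar> \<le> 1 / N
       \<longrightarrow> dist (q i (t, s)) (q i (t', s)) < \<epsilon>)" if "i \<in> L" for i
    by (rule uniform_in_time[OF K q[OF that] \<open>\<epsilon> > 0\<close>]) blast
  then obtain M :: "'i \<Rightarrow> nat" where M: "\<And>i. i \<in> L \<Longrightarrow> (0::nat) < M i"
    "\<And>i s t t'. i \<in> L \<Longrightarrow> s \<in> topspace K \<Longrightarrow> t \<in> {0..1} \<Longrightarrow> t' \<in> {0..1} \<Longrightarrow> \<bar>t - t'\<bar> \<le> 1 / M i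
       \<Longrightarrow> dist (q i (t, s)) (q i (t', s)) < \<epsilon>"
    by metis
  \<comment> \<open>A common number of steps: at least every \<open>M i\<close>, and positive even
    without punctures.\<close>
  define N where "N = Suc (\<Sum>i\<in>L. M i)"
  have "N > 0" by (simp add: N_def)
  have MN: "1 / N \<le> 1 / M i" if "i \<in> L" for i
  proof -
    have "M i \<le> N" using member_le_sum[OF that, of M] L by (simp add: N_def)
    then show ?thesis using M(1)[OF that] by (intro divide_left_mono) auto
  qed
  define r where "r n t = min t (real n / N)" for n t
  note r = step_time[OF \<open>N > 0\<close>, folded r_def]
  define Q where "Q n i = (\<lambda>(t, s). q i (r n t, s))" for n i
  have Q: "continuous_map (cylinder K) euclidean (Q n i)" if "i \<in> L" for n i
    unfolding Q_def using r by (intro continuous_map_retime q that) (auto simp: r_def intro!: continuous_intros)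
  have step: "norm (Q (Suc n) i x - Q n i x) \<le> \<epsilon>" if "i \<in> L" and x: "x \<in> topspace (cylinder K)" for n i x
  proof -
    obtain t s where ts: "x = (t, s)" "t \<in> {0..1}" "s \<in> topspace K" using x by auto
    have "\<bar>r (Suc n) t - r n t\<bar> \<le> 1 / M i" using r(2)[OF ts(2), of n] MN[OF that(1)] by linarith
    then show ?thesis
      using M(2)[OF that(1) ts(3) r(1)[OF ts(2)] r(1)[OF ts(2)]] by (simp add: Q_def ts dist_norm less_imp_le)
  qed
  have "\<exists>h. continuous_map (cylinder K) euclidean h \<and> (\<forall>s\<in>topspace K. h (0, s) = h0 s) \<and>
      (\<forall>i\<in>L. \<forall>x\<in>topspace (cylinder K). h x \<noteq> Q n i x) \<and>
      (\<forall>s\<in>topspace K. (\<forall>i\<in>L. \<forall>t\<in>{0..1}. q i (t, s) = q i (0, s)) \<longrightarrow> (\<forall>t\<in>{0..1}. h (t, s) = h0 s))" for n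
  proof (induction n)
    case 0
    have "continuous_map (cylinder K) euclidean (\<lambda>x. h0 (snd x))"
      using continuous_map_compose[OF continuous_map_snd h0] by (simp add: o_def)
    moreover have "h0 s \<noteq> Q 0 i (t, s)" if "i \<in> L" "t \<in> {0..1}" "s \<in> topspace K" for i t s
      using avoid[OF that(1,3)] that(2) by (simp add: Q_def r_def min_absorb2)
    ultimately show ?case by (intro exI[of _ "\<lambda>x. h0 (snd x)"]) auto
  next
    case (Suc n)
    then obtain h where h: "continuous_map (cylinder K) euclidean h"
      "\<And>s. s \<in> topspace K \<Longrightarrow> h (0, s) = h0 s"
      "\<And>i x. i \<in> L \<Longrightarrow> x \<in> topspace (cylinder K) \<Longrightarrow> h x \<noteq> Q n i x"
      "\<And>s t. s \<in> topspace K \<Longrightarrow> \<forall>i\<in>L. \<forall>t\<in>{0..1}. q i (t, s) = q i (0, s) \<Longrightarrow> t \<in> {0..1} \<Longrightarrow> h (t, s) = h0 s"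
      by blast
    \<comment> \<open>One push, from the punctures stopped at \<open>n / N\<close> to those stopped
      at \<open>(n + 1) / N\<close>, applied at all points of the cylinder at once. At times up to
      \<open>n / N\<close> the two agree and nothing moves.\<close>
    define h' where "h' x = h x + (\<Sum>i\<in>L. of_real (max 0 (1 - 2 * norm (h x - Q n i x) / \<delta>)) * (Q (Suc n) i x - Q n i x))" for x
    have c1: "continuous_map (cylinder K) euclidean h'"
      unfolding h'_def using \<open>\<delta> > 0\<close>
      by (intro continuous_map_add h(1) continuous_map_sum continuous_map_complex_mult L
          continuous_map_complex_of_real continuous_map_real_max continuous_map_diff Q
          continuous_map_real_divide continuous_map_real_mult continuous_map_norm) auto
    have c2: "h' x \<noteq> Q (Suc n) k x" if "k \<in> L" "x \<in> topspace (cylinder K)" for k x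
    proof -
      have "\<delta> \<le> norm (Q n i x - Q n j x)" if "i \<in> L" "j \<in> L" "i \<noteq> j" for i j
        using sep[OF that, of "(r n (fst x), snd x)"] r(1)[of "fst x"] \<open>x \<in> _\<close>
        by (auto simp: Q_def case_prod_beta)
      then show ?thesis
        unfolding h'_def
        using step[OF _ that(2)] h(3)[OF that] that(1) L \<open>\<delta> > 0\<close> \<open>2 * card L * \<epsilon> < \<delta>\<close>
        by (intro push_avoids[where \<epsilon> = \<epsilon>]) auto
    qed
    have c3: "h' (0, s) = h0 s" if "s \<in> topspace K" for s
    proof -
      have "r m 0 = 0" for m by (simp add: r_def)
      then have "Q (Suc n) i (0, s) = Q n i (0, s)" for i by (simp only: Q_def prod.case)
      then show ?thesis using h(2)[OF that] by (simp add: h'_def)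
    qed
    have c4: "h' (t, s) = h0 s"
      if s: "s \<in> topspace K" and still: "\<forall>i\<in>L. \<forall>t\<in>{0..1}. q i (t, s) = q i (0, s)"
        and t: "t \<in> {0..1}" for t s
    proof -
      have "Q m i (t, s) = q i (0, s)" if "i \<in> L" for m i
        using still that r(1)[OF t] unfolding Q_def prod.case by blast
      then have "Q (Suc n) i (t, s) - Q n i (t, s) = 0" if "i \<in> L" for i
        using that by simp
      then show ?thesis using h(4)[OF s still t] by (simp add: h'_def)
    qed
    show ?case
      by (rule exI[of _ h'], intro conjI ballI impI)
        (rule c1, erule c3, (rule c2; assumption), (rule c4; assumption))
  qed
  from this[of N] obtain h where h: "continuous_map (cylinder K) euclidean h"
      "\<forall>s\<in>topspace K. h (0, s) = h0 s"
      "\<forall>i\<in>L. \<forall>x\<in>topspace (cylinder K). h x \<noteq> Q N i x"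
      "\<forall>s\<in>topspace K. (\<forall>i\<in>L. \<forall>t\<in>{0..1}. q i (t, s) = q i (0, s)) \<longrightarrow> (\<forall>t\<in>{0..1}. h (t, s) = h0 s)"
    by blast
  have "h x \<noteq> q i x" if "i \<in> L" "x \<in> topspace (cylinder K)" for i x
  proof -
    have "Q N i x = q i x" using that(2) \<open>N > 0\<close> by (auto simp: Q_def r_def)
    with h(3)[rule_format, OF that] show ?thesis by simp
  qed
  with h(1,2,4) show ?thesis by (intro that[of h]) blast+
qed

section \<open>The cube\<close>

lemma topspace_cube: "topspace (cube k) = {..<k} \<rightarrow>\<^sub>E {0..1}"
  by (simp add: cube_def)

lemma compact_space_cube: "compact_space (cube k)"
  unfolding cube_def by (simp add: compact_space_product_topology compact_space_subtopology)

lemma connected_space_cube: "connected_space (cube k)"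
  unfolding cube_def
  by (simp add: connected_space_product_topology connected_space_top_of_set connected_Icc)

lemma locally_connected_space_cube: "locally_connected_space (cube k)"
  unfolding cube_def
  by (simp add: locally_connected_space_product_topology locally_connected_real_interval)

text \<open>All faces \<open>F i 0\<close> share the origin. The opposite face \<open>F i 1\<close>
  is reached through \<open>F j 0\<close> for another direction \<open>j\<close>: the corner
  \<open>o0(i := 1)\<close> lies in both. A second direction exists because \<open>k\<close> is at
  least 2.\<close>

lemma cube_boundary_connected:
  assumes "k \<ge> 2"
  shows "connectedin (cube k) (cube_boundary k)"
proof -
  define F where "F i c = (\<Pi>\<^sub>E j\<in>{..<k}. if j = i then {c} else {0..1::real})" for i c
  define o0 where "o0 = (\<lambda>j\<in>{..<k}. 0::real)"
  have F: "connectedin (cube k) (F i c)" if "c \<in> {0..1}" for i c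
    unfolding F_def cube_def connectedin_PiE using that
    by (auto simp: connectedin_subtopology)
  have face: "\<exists>T. connectedin (cube k) T \<and> o0 \<in> T \<and> F i 0 \<subseteq> T \<and> F i 1 \<subseteq> T \<and> T \<subseteq> cube_boundary k" if "i < k" for i
  proof -
    obtain j where j: "j < k" "j \<noteq> i"
      using assms that by (cases "i = 0") (auto intro: that[of 1] that[of 0])
    have 0: "o0 \<in> F i 0 \<inter> F j 0" by (auto simp: F_def o0_def)
    have 1: "o0(i := 1) \<in> F i 1 \<inter> (F i 0 \<union> F j 0)"
      using j that by (auto simp: F_def o0_def PiE_def Pi_def extensional_def)
    have 2: "connectedin (cube k) (F i 0 \<union> F j 0)"
      using 0 by (intro connectedin_Un F) auto
    have "connectedin (cube k) (F i 1 \<union> (F i 0 \<union> F j 0))"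
      by (rule connectedin_Un[OF F 2]) (use 1 in auto)
    moreover have "F i c \<subseteq> cube_boundary k" if "c \<in> {0, 1}" "i < k" for i c
      using that by (fastforce simp: F_def cube_boundary_def topspace_cube PiE_def Pi_def split: if_splits)
    ultimately show ?thesis
      using 0 that j by (intro exI[of _ "F i 1 \<union> (F i 0 \<union> F j 0)"]) auto
  qed
  then obtain T where T: "\<And>i. i < k \<Longrightarrow> connectedin (cube k) (T i)" "\<And>i. i < k \<Longrightarrow> o0 \<in> T i"
    "\<And>i. i < k \<Longrightarrow> F i 0 \<subseteq> T i" "\<And>i. i < k \<Longrightarrow> F i 1 \<subseteq> T i" "\<And>i. i < k \<Longrightarrow> T i \<subseteq> cube_boundary k"
    by metis
  have "cube_boundary k \<subseteq> \<Union>(T ` {..<k})"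
  proof
    fix s assume "s \<in> cube_boundary k"
    then obtain i where i: "i < k" "s \<in> topspace (cube k)" "s i = 0 \<or> s i = 1"
      by (auto simp: cube_boundary_def)
    have "s \<in> F i (s i)"
      using i(2) by (simp add: F_def topspace_cube PiE_iff)
    with i(3) have "s \<in> F i 0 \<or> s \<in> F i 1" by metis
    then have "s \<in> T i" using T(3,4)[OF i(1)] by blast
    then show "s \<in> \<Union>(T ` {..<k})" using i(1) by blast
  qed
  then have "cube_boundary k = \<Union>(T ` {..<k})" using T(5) by blast
  moreover have "connectedin (cube k) (\<Union>(T ` {..<k}))"
  proof (rule connectedin_Union)
    have "o0 \<in> \<Inter>(T ` {..<k})" using T(2) by blast
    then show "\<Inter>(T ` {..<k}) \<noteq> {}" by blast
  qed (use T(1) in auto)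
  ultimately show ?thesis by simp
qed

lemma cube_boundary_nonempty:
  assumes "k \<ge> 2"
  shows "cube_boundary k \<noteq> {}"
proof -
  have "(\<lambda>j\<in>{..<k}. 0) \<in> cube_boundary k"
    using assms by (auto simp: cube_boundary_def topspace_cube intro!: exI[of _ 0])
  then show ?thesis by blast
qed

text \<open>The map \<open>c\<close> contracts the cube to the origin, so \<open>g\<close> composed
  with \<open>c\<close> is a homotopy from a constant to \<open>g\<close>. Lifting it from a
  constant logarithm gives a logarithm of \<open>g\<close> at time 1.\<close>

lemma continuous_logarithm_on_cube:
  fixes g :: "(nat \<Rightarrow> real) \<Rightarrow> complex"
  assumes g: "continuous_map (cube k) euclidean g" and g0: "\<And>s. s \<in> topspace (cube k) \<Longrightarrow> g s \<noteq> 0"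
  shows "\<exists>l. continuous_map (cube k) euclidean l \<and> (\<forall>s\<in>topspace (cube k). exp (l s) = g s)"
proof -
  define c where "c x = (\<lambda>i\<in>{..<k}. fst x * snd x i)" for x :: "real \<times> (nat \<Rightarrow> real)"
  have "continuous_map (cylinder (cube k)) (top_of_set {0..1}) (\<lambda>x. c x i)" if "i < k" for i
  proof -
    have "continuous_map (cube k) euclideanreal (\<lambda>s. s i)"
      using continuous_map_product_projection[of i "{..<k}" "\<lambda>_. top_of_set {0..1}"] that
      by (auto simp: cube_def continuous_map_in_subtopology)
    from continuous_map_compose[OF continuous_map_snd this]
    have "continuous_map (cylinder (cube k)) euclideanreal (\<lambda>x. snd x i)" by (simp add: o_def)
    moreover have "continuous_map (cylinder (cube k)) euclideanreal fst"
      by (rule continuous_map_into_fulltopology[OF continuous_map_fst])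
    ultimately have "continuous_map (cylinder (cube k)) euclideanreal (\<lambda>x. c x i)"
      using that by (simp add: c_def continuous_map_real_mult)
    then show ?thesis
      using that by (auto simp: continuous_map_in_subtopology c_def topspace_cube PiE_def Pi_def
          intro!: mult_nonneg_nonneg mult_le_one)
  qed
  then have c: "continuous_map (cylinder (cube k)) (cube k) c"
    unfolding cube_def by (subst continuous_map_componentwise) (auto simp: c_def)
  have 1: "continuous_map (cylinder (cube k)) euclidean (\<lambda>x. g (c x))"
    using continuous_map_compose[OF c g] by (simp add: o_def)
  have 2: "g (c x) \<noteq> 0" if "x \<in> topspace (cylinder (cube k))" for x
    using that c by (intro g0) (metis continuous_map_image_subset_topspace image_subset_iff)
  define o0 where "o0 = (\<lambda>i\<in>{..<k}. 0::real)"
  have "o0 \<in> topspace (cube k)" by (auto simp: o0_def topspace_cube)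
  then have 3: "exp (Ln (g o0)) = g (c (0, s))" for s
    using g0 by (simp add: c_def o0_def)
  obtain l where l: "continuous_map (cylinder (cube k)) euclidean l"
    "\<And>x. x \<in> topspace (cylinder (cube k)) \<Longrightarrow> exp (l x) = g (c x)"
    using logarithm_lift_homotopy[OF compact_space_cube 1 2 _ 3] by auto
  have "c (1, s) = s" if "s \<in> topspace (cube k)" for s
    using that by (auto simp: c_def topspace_cube PiE_def extensional_def)
  then have "exp (l (1, s)) = g s" if "s \<in> topspace (cube k)" for s
    using that l(2)[of "(1, s)"] by simp
  moreover have "continuous_map (cube k) euclidean (\<lambda>s. l (1, s))"
    by (rule continuous_map_slice[OF l(1)]) simp
  ultimately show ?thesis by blast
qed

text \<open>Round discs serve as patches because they and their intersections are convex, which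
  gives the simple connectivity and connectedness that the induction on patches starts from.\<close>

lemma open_plane_set_nullhomotopic:
  fixes f :: "(nat \<Rightarrow> real) \<Rightarrow> complex"
  assumes "k \<ge> 2" "open U" and f: "continuous_map (cube k) euclidean f" "f ` topspace (cube k) \<subseteq> U"
    and b: "\<And>s. s \<in> cube_boundary k \<Longrightarrow> f s = b"
  obtains h where "continuous_map (cylinder (cube k)) euclidean h" "h ` topspace (cylinder (cube k)) \<subseteq> U"
    "\<And>s. s \<in> topspace (cube k) \<Longrightarrow> h (0, s) = f s" "\<And>s. s \<in> topspace (cube k) \<Longrightarrow> h (1, s) = b"
    "\<And>t s. t \<in> {0..1} \<Longrightarrow> s \<in> cube_boundary k \<Longrightarrow> h (t, s) = b"
proof -
  define K where "K = cube k"
  have "\<exists>r>0. ball (f s) r \<subseteq> U" if "s \<in> topspace K" for s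
    using \<open>open U\<close> f(2) that unfolding K_def open_contains_ball by blast
  then obtain r where r: "\<And>s. s \<in> topspace K \<Longrightarrow> r s > 0" "\<And>s. s \<in> topspace K \<Longrightarrow> ball (f s) (r s) \<subseteq> U"
    by metis
  \<comment> \<open>The preimage of a disc need not be connected; local connectedness of the cube
    supplies a connected open piece of it around \<open>s\<close>.\<close>
  have exV: "\<exists>V. openin K V \<and> connectedin K V \<and> s \<in> V \<and> V \<subseteq> {x \<in> topspace K. f x \<in> ball (f s) (r s)}"
    if "s \<in> topspace K" for s
  proof -
    have "openin K {x \<in> topspace K. f x \<in> ball (f s) (r s)}"
      using f(1) unfolding K_def by (rule openin_continuous_map_preimage) simp
    moreover have "s \<in> {x \<in> topspace K. f x \<in> ball (f s) (r s)}" using that r(1) by simp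
    ultimately show ?thesis
      using locally_connected_space_cube[of k] unfolding locally_connected_space K_def by blast
  qed
  define V where "V s = (SOME V. openin K V \<and> connectedin K V \<and> s \<in> V \<and>
    V \<subseteq> {x \<in> topspace K. f x \<in> ball (f s) (r s)})" for s
  note V_props = someI_ex[OF exV, folded V_def]
  have V: "openin K (V s)" "connectedin K (V s)" "s \<in> V s"
    "V s \<subseteq> {x \<in> topspace K. f x \<in> ball (f s) (r s)}" if "s \<in> topspace K" for s
    using V_props[OF that] by blast+
  have "topspace K \<subseteq> \<Union>(V ` topspace K)" using V(3) by blast
  then obtain \<F> where "finite \<F>" "\<F> \<subseteq> V ` topspace K" "topspace K \<subseteq> \<Union>\<F>"
    using compact_space_cube[of k, folded K_def, unfolded compact_space_alt, rule_format, of "V ` topspace K"] V(1)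
    by blast
  then obtain S where S: "finite S" "S \<subseteq> topspace K" "topspace K \<subseteq> \<Union>(V ` S)"
    using finite_subset_image[of \<F> V "topspace K"] by blast
  have SK: "s \<in> topspace K" if "s \<in> S" for s using S(2) that by blast
  have "V s \<subseteq> topspace K" if "s \<in> S" for s
    using openin_subset[OF V(1)[OF SK[OF that]]] .
  then have VK: "\<Union>(V ` S) \<subseteq> topspace K" by blast
  have "\<exists>h. continuous_map (cylinder K) euclidean h \<and> h ` topspace (cylinder K) \<subseteq> \<Union>((\<lambda>s. ball (f s) (r s)) ` S) \<and>
           (\<forall>s\<in>topspace K. h (0, s) = f s \<and> h (1, s) = b) \<and> (\<forall>t\<in>{0..1}. \<forall>s\<in>cube_boundary k. h (t, s) = b)"
  proof (rule nullhomotopic_in_patches[where E = V])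
    show "connected_space K" unfolding K_def by (rule connected_space_cube)
    show "connectedin K (cube_boundary k)" unfolding K_def by (rule cube_boundary_connected) fact
    show "cube_boundary k \<noteq> {}" by (rule cube_boundary_nonempty) fact
    show "topspace K = \<Union>(V ` S)" using VK S(3) by blast
    show "continuous_map K euclidean f" unfolding K_def by fact
    show "\<exists>l. continuous_map K euclidean l \<and> (\<forall>s\<in>topspace K. exp (l s) = g s)"
      if "continuous_map K euclidean g" "\<And>s. s \<in> topspace K \<Longrightarrow> g s \<noteq> 0" for g :: "(nat \<Rightarrow> real) \<Rightarrow> complex"
      using continuous_logarithm_on_cube that unfolding K_def by blast
    show "simply_connected (ball (f s) (r s))" for s
      by (intro convex_imp_simply_connected) simp
    show "connected (ball (f s) (r s) \<inter> ball (f s') (r s'))" for s s'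
      by (intro convex_connected convex_Int) simp_all
    show "f ` V s \<subseteq> ball (f s) (r s)" if "s \<in> S" for s using V(4)[OF SK[OF that]] by blast
    show "connectedin K (V s)" if "s \<in> S" for s using V(2)[OF SK[OF that]] .
    show "V s \<noteq> {}" if "s \<in> S" for s using V(3)[OF SK[OF that]] by blast
  qed (use S(1) b in auto)
  then obtain h where h: "continuous_map (cylinder K) euclidean h"
    "h ` topspace (cylinder K) \<subseteq> \<Union>((\<lambda>s. ball (f s) (r s)) ` S)"
    "\<And>s. s \<in> topspace K \<Longrightarrow> h (0, s) = f s" "\<And>s. s \<in> topspace K \<Longrightarrow> h (1, s) = b"
    "\<And>t s. t \<in> {0..1} \<Longrightarrow> s \<in> cube_boundary k \<Longrightarrow> h (t, s) = b"
    by blast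
  have "h ` topspace (cylinder K) \<subseteq> U" using h(2) r(2)[OF SK] by blast
  with h show ?thesis unfolding K_def by (intro that[of h])
qed

section \<open>Orbit configurations in the plane\<close>

lemma homotopic_rel_cube_boundary:
  "homotopic_with (\<lambda>h. \<forall>s\<in>cube_boundary k. h s = x) (cube k) Y f g \<longleftrightarrow>
     (\<exists>h. continuous_map (cylinder (cube k)) Y h \<and>
        (\<forall>s\<in>topspace (cube k). h (0, s) = f s) \<and> (\<forall>s\<in>topspace (cube k). h (1, s) = g s) \<and>
        (\<forall>t\<in>{0..1}. \<forall>s\<in>cube_boundary k. h (t, s) = x))"
  by (rule homotopic_with) (simp add: cube_boundary_def)

text \<open>This describes \<open>G\<close> acting on the projective line in an affine coordinate,
  with \<open>A\<close> the points of \<open>Z\<close> other than infinity. The clauses concern only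
  points outside \<open>A\<close>, since a homography may send a point of \<open>A\<close> to
  infinity. \<open>act_orbit\<close> condenses composition and inverses: its witness is the inverse
  of \<open>g\<close> times \<open>h\<close>.\<close>

locale plane_action =
  fixes A :: "complex set" and L :: "'g set" and act :: "'g \<Rightarrow> complex \<Rightarrow> complex"
  assumes finite_A: "finite A" and finite_L: "finite L"
    and act_continuous: "g \<in> L \<Longrightarrow> continuous_on (- A) (act g)"
    and act_closed: "g \<in> L \<Longrightarrow> z \<notin> A \<Longrightarrow> act g z \<notin> A"
    and act_free: "g \<in> L \<Longrightarrow> h \<in> L \<Longrightarrow> z \<notin> A \<Longrightarrow> act g z = act h z \<Longrightarrow> g = h"
    and act_orbit: "g \<in> L \<Longrightarrow> h \<in> L \<Longrightarrow> z \<notin> A \<Longrightarrow> w \<notin> A \<Longrightarrow> act g z = act h w \<Longrightarrow> \<exists>k\<in>L. z = act k w"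
    and act_unit: "\<exists>e\<in>L. \<forall>z. z \<notin> A \<longrightarrow> act e z = z"
begin

text \<open>Writing \<open>w\<close> as \<open>act e w\<close> turns \<open>act_orbit\<close> into
  the existence of inverses.\<close>

lemma act_symmetric:
  assumes "g \<in> L" "z \<notin> A" "w \<notin> A" "w = act g z"
  shows "\<exists>k\<in>L. z = act k w"
proof -
  obtain e where e: "e \<in> L" "act e w = w" using act_unit assms(3) by blast
  show ?thesis
    by (rule act_orbit[OF assms(1) e(1) assms(2,3)]) (rule trans[OF assms(4)[symmetric] e(2)[symmetric]])
qed

definition config :: "nat \<Rightarrow> (nat \<Rightarrow> complex) set" where
  "config n = {w \<in> {1..n} \<rightarrow>\<^sub>E - A. \<forall>i\<in>{1..n}. \<forall>j\<in>{1..n}. i \<noteq> j \<longrightarrow> (\<forall>g\<in>L. w i \<noteq> act g (w j))}"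

definition config_space :: "nat \<Rightarrow> (nat \<Rightarrow> complex) topology" where
  "config_space n = subtopology (product_topology (\<lambda>_. euclidean) {1..n}) (config n)"

lemma config_notin: "w \<in> config n \<Longrightarrow> i \<in> {1..n} \<Longrightarrow> w i \<notin> A"
  unfolding config_def by blast

lemma config_neq: "w \<in> config n \<Longrightarrow> i \<in> {1..n} \<Longrightarrow> j \<in> {1..n} \<Longrightarrow> i \<noteq> j \<Longrightarrow> g \<in> L \<Longrightarrow> w i \<noteq> act g (w j)"
  unfolding config_def by blast

lemma config_extensional: "w \<in> config n \<Longrightarrow> w \<in> extensional {1..n}"
  unfolding config_def PiE_def by blast

lemma topspace_config_space: "topspace (config_space n) = config n"
  by (auto simp: config_space_def config_def)

lemma continuous_map_config_space:
  "continuous_map X (config_space n) f \<longleftrightarrow>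
     (\<forall>x\<in>topspace X. f x \<in> config n) \<and> (\<forall>i\<in>{1..n}. continuous_map X euclidean (\<lambda>x. f x i))"
  using config_extensional
  by (auto simp: config_space_def continuous_map_in_subtopology continuous_map_componentwise)

text \<open>The fibre over \<open>w\<close> of the projection that forgets the last point is the
  complement of this finite set.\<close>

definition occupied :: "nat \<Rightarrow> (nat \<Rightarrow> complex) \<Rightarrow> complex set" where
  "occupied n w = A \<union> (\<Union>j\<in>{1..n}. (\<lambda>g. act g (w j)) ` L)"

lemma finite_occupied: "finite (occupied n w)"
  unfolding occupied_def using finite_A finite_L by simp

lemma config_extend:
  assumes w: "w \<in> config n" and z: "z \<notin> occupied n w"
  shows "w(Suc n := z) \<in> config (Suc n)"
proof -
  have zA: "z \<notin> A" and zact: "\<And>g j. g \<in> L \<Longrightarrow> j \<in> {1..n} \<Longrightarrow> z \<noteq> act g (w j)"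
    using z by (auto simp: occupied_def)
  \<comment> \<open>\<open>config\<close> constrains ordered pairs, while \<open>occupied\<close>
    only keeps \<open>z\<close> off the orbits of the old points; symmetry supplies the other
    order.\<close>
  have zact': "w j \<noteq> act g z" if "g \<in> L" "j \<in> {1..n}" for g j
    using act_symmetric[OF that(1) zA config_notin[OF w that(2)]] zact that(2) by blast
  have "w(Suc n := z) \<in> {1..Suc n} \<rightarrow>\<^sub>E - A"
    using w zA by (auto simp: config_def PiE_iff extensional_def)
  moreover have "(w(Suc n := z)) i \<noteq> act g ((w(Suc n := z)) j)"
    if "i \<in> {1..Suc n}" "j \<in> {1..Suc n}" "i \<noteq> j" "g \<in> L" for i j g
  proof (cases "i = Suc n")
    case True
    then show ?thesis using that zact[of g j] by auto
  next
    case False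
    then have i: "i \<in> {1..n}" using that(1) by auto
    show ?thesis
    proof (cases "j = Suc n")
      case True
      then show ?thesis using zact'[OF that(4) i] False by simp
    next
      case j: False
      then have "j \<in> {1..n}" using that(2) by auto
      then show ?thesis using config_neq[OF w i _ that(3,4)] False j by simp
    qed
  qed
  ultimately show ?thesis unfolding config_def by blast
qed

lemma config_Suc:
  assumes "w \<in> config (Suc n)"
  shows "restrict w {1..n} \<in> config n" "w (Suc n) \<notin> occupied n (restrict w {1..n})"
    "(restrict w {1..n})(Suc n := w (Suc n)) = w"
proof -
  show "restrict w {1..n} \<in> config n"
    using config_notin[OF assms] config_neq[OF assms] unfolding config_def by auto
  show "w (Suc n) \<notin> occupied n (restrict w {1..n})"
    using config_notin[OF assms, of "Suc n"] config_neq[OF assms, of "Suc n"]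
    unfolding occupied_def by force
  show "(restrict w {1..n})(Suc n := w (Suc n)) = w"
    using config_extensional[OF assms] by (auto simp: fun_eq_iff extensional_def restrict_def)
qed

lemma continuous_map_config_extend:
  assumes H: "continuous_map X (config_space n) H" and z: "continuous_map X euclidean z"
    and "\<And>x. x \<in> topspace X \<Longrightarrow> z x \<notin> occupied n (H x)"
  shows "continuous_map X (config_space (Suc n)) (\<lambda>x. (H x)(Suc n := z x))"
  unfolding continuous_map_config_space
proof (intro conjI ballI)
  show "(H x)(Suc n := z x) \<in> config (Suc n)" if "x \<in> topspace X" for x
    using H assms(3) that unfolding continuous_map_config_space by (intro config_extend) auto
  fix i assume i: "i \<in> {1..Suc n}"
  show "continuous_map X euclidean (\<lambda>x. ((H x)(Suc n := z x)) i)"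
  proof (cases "i = Suc n")
    case False
    then have "i \<in> {1..n}" using i by auto
    then show ?thesis using H False unfolding continuous_map_config_space by simp
  qed (use z in simp)
qed

text \<open>The homotopy lifting property of the projection that forgets the last point.\<close>

lemma lift_homotopy:
  assumes K: "compact_space K" and H: "continuous_map (cylinder K) (config_space n) H"
    and f: "continuous_map K (config_space (Suc n)) f"
    and start: "\<And>s. s \<in> topspace K \<Longrightarrow> H (0, s) = restrict (f s) {1..n}"
  obtains z where "continuous_map (cylinder K) (config_space (Suc n)) (\<lambda>x. (H x)(Suc n := z x))"
    "\<And>s. s \<in> topspace K \<Longrightarrow> z (0, s) = f s (Suc n)"
    "\<And>s t. s \<in> topspace K \<Longrightarrow> t \<in> {0..1} \<Longrightarrow> \<forall>t\<in>{0..1}. H (t, s) = H (0, s) \<Longrightarrow> z (t, s) = f s (Suc n)"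
proof -
  have Hc: "H x \<in> config n" if "x \<in> topspace (cylinder K)" for x
    using H that unfolding continuous_map_config_space by blast
  have fc: "f s \<in> config (Suc n)" if "s \<in> topspace K" for s
    using f that unfolding continuous_map_config_space by blast
  \<comment> \<open>Punctures are indexed so that each is a continuous function on the cylinder:
    \<open>Inl a\<close> stays at \<open>a\<close>, and \<open>Inr (j, g)\<close> follows the
    translate by \<open>g\<close> of the point number \<open>j\<close>.\<close>
  define M where "M = Inl ` A \<union> Inr ` ({1..n} \<times> L)"
  define q where "q m x = (case m of Inl a \<Rightarrow> a | Inr p \<Rightarrow> act (snd p) (H x (fst p)))" for m x
  have occ: "occupied n (H x) = (\<lambda>m. q m x) ` M" for x
  proof -
    have "(\<lambda>p. act (snd p) (H x (fst p))) ` ({1..n} \<times> L) = (\<Union>j\<in>{1..n}. (\<lambda>g. act g (H x j)) ` L)"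
      unfolding Sigma_def image_UN by auto
    then show ?thesis
      unfolding occupied_def M_def image_Un image_image q_def sum.case by simp
  qed
  have m1: "finite M" unfolding M_def using finite_A finite_L by simp
  have m2: "continuous_map (cylinder K) euclidean (q m)" if m: "m \<in> M" for m
  proof (cases m)
    case (Inl a)
    then have "q m = (\<lambda>_. a)" by (simp add: q_def fun_eq_iff)
    then show ?thesis by simp
  next
    case (Inr p)
    then have p: "fst p \<in> {1..n}" "snd p \<in> L" using m by (auto simp: M_def)
    have "continuous_map (cylinder K) euclidean (\<lambda>x. act (snd p) (H x (fst p)))"
    proof (rule continuous_map_compose_continuous_on[OF _ act_continuous[OF p(2)]])
      show "continuous_map (cylinder K) euclidean (\<lambda>x. H x (fst p))"
        using H p(1) unfolding continuous_map_config_space by blast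
      show "H x (fst p) \<in> - A" if "x \<in> topspace (cylinder K)" for x
        using config_notin[OF Hc[OF that] p(1)] by simp
    qed
    moreover have "q m = (\<lambda>x. act (snd p) (H x (fst p)))" by (simp add: q_def Inr fun_eq_iff)
    ultimately show ?thesis by simp
  qed
  \<comment> \<open>Punctures with different indices never collide: a resting and a moving one by
    \<open>act_closed\<close>, two translates of the same point by freeness, translates of two
    points because their orbits are disjoint.\<close>
  have m3: "q m x \<noteq> q m' x"
    if m: "m \<in> M" "m' \<in> M" "m \<noteq> m'" and x: "x \<in> topspace (cylinder K)" for m m' x
  proof -
    note notin = config_notin[OF Hc[OF x]] and neq = config_neq[OF Hc[OF x]]
    have mixed: "a \<noteq> act g (H x j)" if "a \<in> A" "j \<in> {1..n}" "g \<in> L" for a j g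
      using act_closed[OF that(3) notin[OF that(2)]] that(1) by auto
    have moving: "act g (H x i) \<noteq> act h (H x j)"
      if "i \<in> {1..n}" "g \<in> L" "j \<in> {1..n}" "h \<in> L" "(i, g) \<noteq> (j, h)" for i g j h
    proof
      assume eq: "act g (H x i) = act h (H x j)"
      show False
      proof (cases "i = j")
        case True
        then show False using act_free[OF that(2,4) notin[OF that(1)]] eq that(5) by simp
      next
        case False
        then show False
          using act_orbit[OF that(2,4) notin[OF that(1)] notin[OF that(3)] eq] neq[OF that(1,3)] by blast
      qed
    qed
    show ?thesis
    proof (cases m)
      case m1: (Inl a)
      show ?thesis
      proof (cases m')
        case (Inl b)
        then show ?thesis using m m1 by (simp add: q_def)
      next
        case (Inr p)
        then show ?thesis using m m1 mixed[of a "fst p" "snd p"] by (auto simp: q_def M_def)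
      qed
    next
      case m1: (Inr p)
      show ?thesis
      proof (cases m')
        case (Inl b)
        then show ?thesis using m m1 mixed[of b "fst p" "snd p"] by (auto simp: q_def M_def)
      next
        case (Inr p')
        then show ?thesis
          using m m1 moving[of "fst p" "snd p" "fst p'" "snd p'"] by (auto simp: q_def M_def)
      qed
    qed
  qed
  have m4: "continuous_map K euclidean (\<lambda>s. f s (Suc n))"
    using f unfolding continuous_map_config_space by simp
  have m5: "f s (Suc n) \<noteq> q m (0, s)" if "m \<in> M" "s \<in> topspace K" for m s
  proof -
    have "f s (Suc n) \<notin> occupied n (H (0, s))"
      unfolding start[OF that(2)] by (rule config_Suc(2)[OF fc[OF that(2)]])
    then show ?thesis unfolding occ using that(1) by blast
  qed
  show ?thesis
  proof (rule moving_punctures_lift[OF K m1, of q "\<lambda>s. f s (Suc n)"])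
    show "continuous_map (cylinder K) euclidean (q m)" if "m \<in> M" for m by (rule m2[OF that])
    show "q m x \<noteq> q m' x" if "m \<in> M" "m' \<in> M" "m \<noteq> m'" "x \<in> topspace (cylinder K)" for m m' x
      by (rule m3[OF that])
    show "continuous_map K euclidean (\<lambda>s. f s (Suc n))" by (rule m4)
    show "f s (Suc n) \<noteq> q m (0, s)" if "m \<in> M" "s \<in> topspace K" for m s by (rule m5[OF that])
    fix z
    assume z: "continuous_map (cylinder K) euclidean z"
      "\<And>s. s \<in> topspace K \<Longrightarrow> z (0, s) = f s (Suc n)"
      "\<And>m x. m \<in> M \<Longrightarrow> x \<in> topspace (cylinder K) \<Longrightarrow> z x \<noteq> q m x"
      "\<And>s t. s \<in> topspace K \<Longrightarrow> t \<in> {0..1} \<Longrightarrow> \<forall>m\<in>M. \<forall>t\<in>{0..1}. q m (t, s) = q m (0, s)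
         \<Longrightarrow> z (t, s) = f s (Suc n)"
    show thesis
  proof (rule that)
    show "continuous_map (cylinder K) (config_space (Suc n)) (\<lambda>x. (H x)(Suc n := z x))"
    proof (rule continuous_map_config_extend[OF H z(1)])
      show "z x \<notin> occupied n (H x)" if "x \<in> topspace (cylinder K)" for x
        unfolding occ using z(3)[OF _ that] by blast
    qed
    show "z (0, s) = f s (Suc n)" if "s \<in> topspace K" for s by (rule z(2)[OF that])
    fix s and t :: real assume s: "s \<in> topspace K" and t: "t \<in> {0..1}"
      and still: "\<forall>t\<in>{0..1}. H (t, s) = H (0, s)"
    show "z (t, s) = f s (Suc n)"
    proof (rule z(4)[OF s t], intro ballI)
      show "q m (t, s) = q m (0, s)" if "t \<in> {0..1}" for m t
        unfolding q_def still[rule_format, OF that] ..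
    qed
  qed
  qed
qed

section \<open>Connectivity and higher homotopy of planar configurations\<close>

lemma config_nonempty: "config n \<noteq> {}"
proof (induction n)
  case 0
  have "(\<lambda>_. undefined) \<in> config 0" by (simp add: config_def)
  then show ?case by blast
next
  case (Suc n)
  then obtain w where "w \<in> config n" by blast
  moreover obtain z where "z \<notin> occupied n w"
    using ex_new_if_finite[OF _ finite_occupied] infinite_UNIV_char_0 by blast
  ultimately show ?case using config_extend by blast
qed

text \<open>A path between the projections, lifted from \<open>x\<close>, ends in the fibre of
  \<open>y\<close> but possibly at the wrong last point. A second path inside that fibre, the plane
  without finitely many points, corrects this.\<close>

lemma path_component_config:
  "x \<in> config n \<Longrightarrow> y \<in> config n \<Longrightarrow> path_component_of (config_space n) x y"
proof (induction n arbitrary: x y)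
  case 0
  then have "x = y" by (simp add: config_def)
  with 0 show ?case by (simp add: path_component_of_refl topspace_config_space)
next
  case (Suc n)
  define x' y' where "x' = restrict x {1..n}" and "y' = restrict y {1..n}"
  note cx = config_Suc[OF Suc.prems(1), folded x'_def] and cy = config_Suc[OF Suc.prems(2), folded y'_def]
  obtain p where p: "pathin (config_space n) p" "p 0 = x'" "p 1 = y'"
    using Suc.IH[OF cx(1) cy(1)] unfolding path_component_of_def by blast
  \<comment> \<open>Over a one-point space, homotopy lifting is path lifting.\<close>
  define K where "K = top_of_set {0::real}"
  have K: "compact_space K" unfolding K_def by (simp add: compact_space_subtopology)
  have H: "continuous_map (cylinder K) (config_space n) (\<lambda>x. p (fst x))"
    using continuous_map_compose[OF continuous_map_fst p(1)[unfolded pathin_def]] by (simp add: o_def)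
  have f: "continuous_map K (config_space (Suc n)) (\<lambda>_. x)"
    using Suc.prems by (simp add: topspace_config_space)
  obtain z where z: "continuous_map (cylinder K) (config_space (Suc n)) (\<lambda>x. (p (fst x))(Suc n := z x))"
    "z (0, 0) = x (Suc n)"
    by (rule lift_homotopy[OF K H f]) (auto simp: p x'_def K_def)
  have "continuous_map (top_of_set {0..1}) (cylinder K) (\<lambda>t. (t, 0))"
    unfolding K_def by (auto intro!: continuous_intros)
  from continuous_map_compose[OF this z(1)]
  have "pathin (config_space (Suc n)) (\<lambda>t. (p t)(Suc n := z (t, 0)))"
    by (simp add: pathin_def o_def)
  then have 1: "path_component_of (config_space (Suc n)) x (y'(Suc n := z (1, 0)))"
    unfolding path_component_of_def using p(2,3) z(2) cx(3)
    by (intro exI[of _ "\<lambda>t. (p t)(Suc n := z (t, 0))"]) simp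
  define U where "U = - occupied n y'"
  have "y'(Suc n := z (1, 0)) \<in> config (Suc n)"
    using conjunct1[OF z(1)[unfolded continuous_map_config_space], rule_format, of "(1, 0)"]
    by (simp add: K_def p(3))
  from config_Suc(2)[OF this] have "z (1, 0) \<in> U"
    using config_extensional[OF cy(1)] by (simp add: U_def restrict_upd extensional_restrict)
  moreover have "y (Suc n) \<in> U" using cy(2) by (simp add: U_def)
  moreover have "path_connected U"
    unfolding U_def by (rule path_connected_complement_countable) (simp_all add: finite_occupied countable_finite)
  ultimately obtain c where c: "path c" "path_image c \<subseteq> U" "pathstart c = z (1, 0)" "pathfinish c = y (Suc n)"
    unfolding path_connected_def by blast
  have "continuous_map (top_of_set {0..1}) (config_space (Suc n)) (\<lambda>t. y'(Suc n := c t))"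
  proof (rule continuous_map_config_extend)
    show "continuous_map (top_of_set {0..1}) euclidean c" using c(1) by (simp add: path_def)
    show "c t \<notin> occupied n y'" if "t \<in> topspace (top_of_set {0..1})" for t
    proof -
      have "c t \<in> path_image c" using that by (simp add: path_image_def)
      then show ?thesis using c(2) unfolding U_def by blast
    qed
  qed (use cy(1) in \<open>simp add: topspace_config_space\<close>)
  then have 2: "path_component_of (config_space (Suc n)) (y'(Suc n := z (1, 0))) y"
    unfolding path_component_of_def pathin_def using c(3,4) cy(3)
    by (intro exI[of _ "\<lambda>t. y'(Suc n := c t)"]) (auto simp: pathstart_def pathfinish_def)
  show ?case by (rule path_component_of_trans[OF 1 2])
qed

text \<open>This is exactness of the homotopy sequence at the total space, done by hand. The lifted
  contraction of the projected spheroid moves \<open>f\<close> into the fibre over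
  \<open>x'\<close>, where it contracts as a map into an open plane set. Both homotopies are
  relative to the cube boundary, so they can be concatenated.\<close>

lemma config_spheroid_nullhomotopic:
  assumes "k \<ge> 2" "continuous_map (cube k) (config_space n) f" "\<And>s. s \<in> cube_boundary k \<Longrightarrow> f s = x"
  shows "homotopic_with (\<lambda>h. \<forall>s\<in>cube_boundary k. h s = x) (cube k) (config_space n) f (\<lambda>_. x)"
  using assms(2,3)
proof (induction n arbitrary: f x)
  case 0
  obtain s0 where s0: "s0 \<in> cube_boundary k" using cube_boundary_nonempty[OF assms(1)] by blast
  have f: "f s \<in> config 0" if "s \<in> topspace (cube k)" for s
    using 0(1) that unfolding continuous_map_config_space by blast
  have "f s = f s0" if "s \<in> topspace (cube k)" for s
    using f[OF that] f[of s0] s0 by (simp add: config_def cube_boundary_def)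
  then show ?case
    using 0 s0 by (intro homotopic_with_equal) auto
next
  case (Suc n)
  obtain s0 where s0: "s0 \<in> cube_boundary k" using cube_boundary_nonempty[OF assms(1)] by blast
  have bd: "s \<in> topspace (cube k)" if "s \<in> cube_boundary k" for s
    using that by (simp add: cube_boundary_def)
  have fc: "f s \<in> config (Suc n)" if "s \<in> topspace (cube k)" for s
    using Suc.prems(1) that unfolding continuous_map_config_space by blast
  have xc: "x \<in> config (Suc n)" using fc[OF bd[OF s0]] Suc.prems(2)[OF s0] by simp
  define x' where "x' = restrict x {1..n}"
  note cx = config_Suc[OF xc, folded x'_def]
  have "continuous_map (cube k) (config_space n) (\<lambda>s. restrict (f s) {1..n})"
    using Suc.prems(1) config_Suc(1)[OF fc] unfolding continuous_map_config_space by auto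
  then have "homotopic_with (\<lambda>h. \<forall>s\<in>cube_boundary k. h s = x') (cube k) (config_space n)
      (\<lambda>s. restrict (f s) {1..n}) (\<lambda>_. x')"
    by (rule Suc.IH) (simp add: Suc.prems(2) x'_def)
  then obtain H where H: "continuous_map (cylinder (cube k)) (config_space n) H"
    "\<And>s. s \<in> topspace (cube k) \<Longrightarrow> H (0, s) = restrict (f s) {1..n}"
    "\<And>s. s \<in> topspace (cube k) \<Longrightarrow> H (1, s) = x'"
    "\<And>t s. t \<in> {0..1} \<Longrightarrow> s \<in> cube_boundary k \<Longrightarrow> H (t, s) = x'"
    unfolding homotopic_rel_cube_boundary by blast
  obtain z where z: "continuous_map (cylinder (cube k)) (config_space (Suc n)) (\<lambda>x. (H x)(Suc n := z x))"
    "\<And>s. s \<in> topspace (cube k) \<Longrightarrow> z (0, s) = f s (Suc n)"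
    "\<And>s t. s \<in> topspace (cube k) \<Longrightarrow> t \<in> {0..1} \<Longrightarrow> \<forall>t\<in>{0..1}. H (t, s) = H (0, s) \<Longrightarrow> z (t, s) = f s (Suc n)"
    using lift_homotopy[OF compact_space_cube H(1) Suc.prems(1) H(2)] by blast
  \<comment> \<open>Over the boundary \<open>H\<close> is constant in time, so by the last clause of
    \<open>lift_homotopy\<close> the lifted point does not move there.\<close>
  have zbd: "z (t, s) = x (Suc n)" if "s \<in> cube_boundary k" "t \<in> {0..1}" for s t
    using z(3)[OF bd[OF that(1)] that(2)] H(4)[OF _ that(1)] Suc.prems(2)[OF that(1)] by simp
  have 1: "homotopic_with (\<lambda>h. \<forall>s\<in>cube_boundary k. h s = x) (cube k) (config_space (Suc n))
      f (\<lambda>s. x'(Suc n := z (1, s)))"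
    unfolding homotopic_rel_cube_boundary
  proof (intro exI conjI ballI)
    show "continuous_map (cylinder (cube k)) (config_space (Suc n)) (\<lambda>x. (H x)(Suc n := z x))" by (rule z(1))
    show "(H (0, s))(Suc n := z (0, s)) = f s" if "s \<in> topspace (cube k)" for s
      unfolding H(2)[OF that] z(2)[OF that] by (rule config_Suc(3)[OF fc[OF that]])
    show "(H (1, s))(Suc n := z (1, s)) = x'(Suc n := z (1, s))" if "s \<in> topspace (cube k)" for s
      unfolding H(3)[OF that] ..
    show "(H (t, s))(Suc n := z (t, s)) = x" if "t \<in> {0..1}" "s \<in> cube_boundary k" for t s
      unfolding H(4)[OF that] zbd[OF that(2,1)] by (rule cx(3))
  qed
  define U where "U = - occupied n x'"
  have "open U" unfolding U_def using finite_occupied finite_imp_closed by blast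
  have zc: "continuous_map (cube k) (config_space (Suc n)) (\<lambda>s. x'(Suc n := z (1, s)))"
    using homotopic_with_imp_continuous_maps[OF 1] by simp
  have z1: "continuous_map (cube k) euclidean (\<lambda>s. z (1, s))"
    using conjunct2[OF zc[unfolded continuous_map_config_space], rule_format, of "Suc n"] by simp
  have zU: "(\<lambda>s. z (1, s)) ` topspace (cube k) \<subseteq> U"
  proof
    fix w assume "w \<in> (\<lambda>s. z (1, s)) ` topspace (cube k)"
    then obtain s where s: "s \<in> topspace (cube k)" "w = z (1, s)" by blast
    have "x'(Suc n := z (1, s)) \<in> config (Suc n)"
      using zc s(1) unfolding continuous_map_config_space by blast
    from config_Suc(2)[OF this] show "w \<in> U"
      using config_extensional[OF cx(1)] by (simp add: U_def s(2) restrict_upd extensional_restrict)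
  qed
  obtain h where h: "continuous_map (cylinder (cube k)) euclidean h" "h ` topspace (cylinder (cube k)) \<subseteq> U"
    "\<And>s. s \<in> topspace (cube k) \<Longrightarrow> h (0, s) = z (1, s)" "\<And>s. s \<in> topspace (cube k) \<Longrightarrow> h (1, s) = x (Suc n)"
    "\<And>t s. t \<in> {0..1} \<Longrightarrow> s \<in> cube_boundary k \<Longrightarrow> h (t, s) = x (Suc n)"
    by (rule open_plane_set_nullhomotopic[OF assms(1) \<open>open U\<close> z1 zU zbd]) auto
  have 2: "homotopic_with (\<lambda>h. \<forall>s\<in>cube_boundary k. h s = x) (cube k) (config_space (Suc n))
      (\<lambda>s. x'(Suc n := z (1, s))) (\<lambda>_. x)"
    unfolding homotopic_rel_cube_boundary
  proof (intro exI conjI ballI)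
    show "continuous_map (cylinder (cube k)) (config_space (Suc n)) (\<lambda>y. x'(Suc n := h y))"
      by (rule continuous_map_config_extend[OF _ h(1)])
        (use cx(1) h(2) in \<open>auto simp: U_def topspace_config_space\<close>)
    show "x'(Suc n := h (0, s)) = x'(Suc n := z (1, s))" if "s \<in> topspace (cube k)" for s
      unfolding h(3)[OF that] ..
    show "x'(Suc n := h (1, s)) = x" if "s \<in> topspace (cube k)" for s
      unfolding h(4)[OF that] by (rule cx(3))
    show "x'(Suc n := h (t, s)) = x" if "t \<in> {0..1}" "s \<in> cube_boundary k" for t s
      unfolding h(5)[OF that] by (rule cx(3))
  qed
  show ?case by (rule homotopic_with_trans[OF 1 2])
qed

end

section \<open>From contractions of spheroids to asphericity\<close>

lemma aspherical_spaceI: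
  assumes "topspace X \<noteq> {}" "path_connected_space X"
    and null: "\<And>k f x. k \<ge> 2 \<Longrightarrow> x \<in> topspace X \<Longrightarrow> continuous_map (cube k) X f \<Longrightarrow>
      (\<And>s. s \<in> cube_boundary k \<Longrightarrow> f s = x) \<Longrightarrow>
      homotopic_with (\<lambda>h. \<forall>s\<in>cube_boundary k. h s = x) (cube k) X f (\<lambda>_. x)"
  shows "aspherical_space X"
  unfolding aspherical_space_def
proof (intro conjI allI impI ballI assms(1,2))
  fix k x assume k: "k \<ge> (2::nat)" and x: "x \<in> topspace X"
  define S where "S = spheroids k X x"
  define R where "R = {(f, g). f \<in> S \<and> g \<in> S \<and>
          homotopic_with (\<lambda>h. \<forall>s\<in>cube_boundary k. h s = x) (cube k) X f g}"
  have const: "homotopic_with (\<lambda>h. \<forall>s\<in>cube_boundary k. h s = x) (cube k) X f (\<lambda>_. x)" if "f \<in> S" for f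
    using that unfolding S_def spheroids_def by (intro null k x) auto
  \<comment> \<open>Any two spheroids are related through the constant one, which is itself a
    spheroid; hence there is exactly one class.\<close>
  have "R `` {f} = S" if "f \<in> S" for f
  proof -
    have "(f, g) \<in> R" if "g \<in> S" for g
      unfolding R_def
      using homotopic_with_trans[OF const[OF \<open>f \<in> S\<close>] homotopic_with_symD[OF const[OF that]]]
        \<open>f \<in> S\<close> that by simp
    then show ?thesis unfolding R_def by blast
  qed
  moreover have "(\<lambda>_. x) \<in> S" using x by (simp add: S_def spheroids_def)
  ultimately have "S // R = {S}" unfolding quotient_def by blast
  then show "is_singleton (homotopy_classes k X x)"
    unfolding homotopy_classes_def S_def[symmetric] R_def[symmetric] by simp
qed

lemma spheroid_nullhomotopic_transfer:
  assumes maps: "homeomorphic_maps X Y p q" and f: "continuous_map (cube k) X f"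
    and null: "homotopic_with (\<lambda>h. \<forall>s\<in>cube_boundary k. h s = p x) (cube k) Y (\<lambda>s. p (f s)) (\<lambda>_. p x)"
    and x: "x \<in> topspace X"
  shows "homotopic_with (\<lambda>h. \<forall>s\<in>cube_boundary k. h s = x) (cube k) X f (\<lambda>_. x)"
proof -
  have q: "continuous_map Y X q" and qp: "\<And>y. y \<in> topspace X \<Longrightarrow> q (p y) = y"
    using maps by (auto simp: homeomorphic_maps_def)
  obtain h where h: "continuous_map (cylinder (cube k)) Y h"
    "\<And>s. s \<in> topspace (cube k) \<Longrightarrow> h (0, s) = p (f s)" "\<And>s. s \<in> topspace (cube k) \<Longrightarrow> h (1, s) = p x"
    "\<And>t s. t \<in> {0..1} \<Longrightarrow> s \<in> cube_boundary k \<Longrightarrow> h (t, s) = p x"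
    using null unfolding homotopic_rel_cube_boundary by blast
  have fX: "f s \<in> topspace X" if "s \<in> topspace (cube k)" for s
    using continuous_map_image_subset_topspace[OF f] that by blast
  show ?thesis
    unfolding homotopic_rel_cube_boundary
  proof (intro exI conjI ballI)
    show "continuous_map (cylinder (cube k)) X (\<lambda>y. q (h y))"
      using continuous_map_compose[OF h(1) q] by (simp add: o_def)
    show "q (h (0, s)) = f s" if "s \<in> topspace (cube k)" for s
      unfolding h(2)[OF that] by (rule qp[OF fX[OF that]])
    show "q (h (1, s)) = x" if "s \<in> topspace (cube k)" for s
      unfolding h(3)[OF that] by (rule qp[OF x])
    show "q (h (t, s)) = x" if "t \<in> {0..1}" "s \<in> cube_boundary k" for t s
      unfolding h(4)[OF that] by (rule qp[OF x])
  qed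
qed

lemma (in plane_action) aspherical_if_homeomorphic_config_space:
  assumes maps: "homeomorphic_maps X (config_space n) p q"
  shows "aspherical_space X"
proof (rule aspherical_spaceI)
  have hom: "X homeomorphic_space config_space n"
    using maps by (auto simp: homeomorphic_space_def)
  show "topspace X \<noteq> {}"
    using homeomorphic_empty_space[OF hom] config_nonempty by (metis topspace_config_space null_topspace_iff_trivial)
  have "path_connected_space (config_space n)"
    unfolding path_connected_space_iff_path_component topspace_config_space
    using path_component_config by blast
  then show "path_connected_space X"
    using homeomorphic_path_connected_space[OF hom] by blast
  fix k f x
  assume *: "2 \<le> k" "x \<in> topspace X" "continuous_map (cube k) X f" "\<And>s. s \<in> cube_boundary k \<Longrightarrow> f s = x"
  have "continuous_map X (config_space n) p" using maps by (simp add: homeomorphic_maps_def)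
  from continuous_map_compose[OF *(3) this]
  have "continuous_map (cube k) (config_space n) (\<lambda>s. p (f s))" by (simp add: o_def)
  then show "homotopic_with (\<lambda>h. \<forall>s\<in>cube_boundary k. h s = x) (cube k) X f (\<lambda>_. x)"
    by (intro spheroid_nullhomotopic_transfer[OF maps *(3) _ *(2)] config_spheroid_nullhomotopic[OF *(1)])
      (simp_all add: *(4))
qed

section \<open>The projective line\<close>

lemma span_singleton_eq_iff:
  fixes v w :: "complex ^ 2"
  assumes "v \<noteq> 0" "w \<noteq> 0"
  shows "vec.span {v} = vec.span {w} \<longleftrightarrow> (\<exists>k. k \<noteq> 0 \<and> w = k *s v)"
proof
  assume "vec.span {v} = vec.span {w}"
  then have "w \<in> vec.span {v}" by (simp add: vec.span_base)
  then obtain k where "w = k *s v" by (auto simp: vec.span_singleton)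
  with assms show "\<exists>k. k \<noteq> 0 \<and> w = k *s v" by (cases "k = 0") auto
next
  assume "\<exists>k. k \<noteq> 0 \<and> w = k *s v"
  then obtain k where k: "k \<noteq> 0" "w = k *s v" by blast
  then have "v = (1 / k) *s w" by (simp add: vec_eq_iff)
  then have "v \<in> vec.span {w}" unfolding vec.span_singleton by blast
  moreover have "w \<in> vec.span {v}" unfolding vec.span_singleton k(2) by blast
  ultimately show "vec.span {v} = vec.span {w}" unfolding vec.span_eq by simp
qed

lemma proj_lineE:
  assumes "p \<in> topspace proj_line"
  obtains v where "v \<noteq> 0" "p = vec.span {v}"
  using assms by (auto simp: topspace_proj_line)

lemma span_in_proj_line: "v \<noteq> 0 \<Longrightarrow> vec.span {v} \<in> topspace proj_line"
  by (auto simp: topspace_proj_line)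

lemma quotient_map_proj_line: "quotient_map (top_of_set (UNIV - {0})) proj_line (\<lambda>v. vec.span {v})"
  unfolding proj_line_def by (rule quotient_map_quotient_topology)

section \<open>Homographies as a continuous group action\<close>

lemma invertible_mult_vec_nonzero:
  fixes A :: mat2
  assumes "invertible A" "v \<noteq> 0"
  shows "A *v v \<noteq> 0"
proof
  assume "A *v v = 0"
  obtain B where "B ** A = mat 1" using assms(1) by (auto simp: invertible_def)
  then have "v = B *v (A *v v)" by (simp add: matrix_vector_mul_assoc)
  then show False using \<open>A *v v = 0\<close> assms(2) by simp
qed

lemma carrier_PGL2E:
  assumes "g \<in> carrier PGL2"
  obtains A where "invertible A" "g = scalars #>\<^bsub>GL2\<^esub> A"
  using assms by (auto simp: PGL2_def FactGroup_def RCOSETS_def GL2_def)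

lemma homography_closed:
  assumes "g \<in> carrier PGL2" "p \<in> topspace proj_line"
  shows "homography g p \<in> topspace proj_line"
proof -
  obtain A where A: "invertible A" "g = scalars #>\<^bsub>GL2\<^esub> A" by (rule carrier_PGL2E[OF assms(1)])
  obtain v where v: "v \<noteq> 0" "p = vec.span {v}" by (rule proj_lineE[OF assms(2)])
  show ?thesis
    unfolding A(2) v(2) homography_coset
    by (rule span_in_proj_line[OF invertible_mult_vec_nonzero[OF A(1) v(1)]])
qed

lemma continuous_map_homography:
  assumes "g \<in> carrier PGL2"
  shows "continuous_map proj_line proj_line (homography g)"
proof -
  obtain A where A: "invertible A" "g = scalars #>\<^bsub>GL2\<^esub> A" by (rule carrier_PGL2E[OF assms])
  have "continuous_map (top_of_set (UNIV - {0})) (top_of_set (UNIV - {0})) (\<lambda>v. A *v v)"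
    using invertible_mult_vec_nonzero[OF A(1)]
    by (auto intro!: matrix_vector_mult_linear_continuous_on)
  from continuous_map_compose[OF this quotient_imp_continuous_map[OF quotient_map_proj_line]]
  have "continuous_map (top_of_set (UNIV - {0})) proj_line (homography g \<circ> (\<lambda>v. vec.span {v}))"
    by (simp add: o_def A(2) homography_coset)
  then show ?thesis
    by (rule continuous_compose_quotient_map[OF quotient_map_proj_line])
qed

lemma homography_mult:
  assumes "g \<in> carrier PGL2" "h \<in> carrier PGL2" "p \<in> topspace proj_line"
  shows "homography (g \<otimes>\<^bsub>PGL2\<^esub> h) p = homography g (homography h p)"
proof -
  obtain A where A: "invertible A" "g = scalars #>\<^bsub>GL2\<^esub> A" by (rule carrier_PGL2E[OF assms(1)])
  obtain B where B: "invertible B" "h = scalars #>\<^bsub>GL2\<^esub> B" by (rule carrier_PGL2E[OF assms(2)])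
  obtain v where v: "v \<noteq> 0" "p = vec.span {v}" by (rule proj_lineE[OF assms(3)])
  have "g \<otimes>\<^bsub>PGL2\<^esub> h = scalars #>\<^bsub>GL2\<^esub> (A ** B)"
    using normal.rcos_sum[OF normal_scalars, of A B] A(1) B(1)
    by (simp add: A(2) B(2) PGL2_def FactGroup_def GL2_def)
  then show ?thesis
    by (simp add: A(2) B(2) v(2) homography_coset matrix_vector_mul_assoc)
qed

lemma homography_one:
  assumes "p \<in> topspace proj_line"
  shows "homography \<one>\<^bsub>PGL2\<^esub> p = p"
proof -
  obtain v where v: "v \<noteq> 0" "p = vec.span {v}" by (rule proj_lineE[OF assms])
  have "\<one>\<^bsub>PGL2\<^esub> = scalars #>\<^bsub>GL2\<^esub> mat 1"
    by (auto simp: PGL2_def FactGroup_def r_coset_def GL2_def)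
  then show ?thesis by (simp add: v(2) homography_coset)
qed

text \<open>An eigenvector of a representing matrix spans a fixed line, and over the complex numbers
  one always exists. For a nontrivial element of \<open>G\<close> the fixed point must lie in
  \<open>Z\<close>.\<close>

lemma homography_fixed_point:
  assumes "g \<in> carrier PGL2"
  obtains p where "p \<in> topspace proj_line" "homography g p = p"
proof -
  obtain A where A: "invertible A" "g = scalars #>\<^bsub>GL2\<^esub> A" by (rule carrier_PGL2E[OF assms])
  define a b c d where "a = A$1$1" and "b = A$1$2" and "c = A$2$1" and "d = A$2$2"
  note abcd = this
  have Av: "A *v v = vector [a * v$1 + b * v$2, c * v$1 + d * v$2]" for v
    by (simp add: matrix_vector_mult_def vec_eq_iff sum_2 forall_2 abcd)
  \<comment> \<open>The quadratic formula for the characteristic equation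
    \<open>(l - a) * (l - d) = b * c\<close>.\<close>
  define l where "l = (a + d + csqrt ((a - d)\<^sup>2 + 4 * b * c)) / 2"
  have "2 * l - (a + d) = csqrt ((a - d)\<^sup>2 + 4 * b * c)"
    by (simp add: l_def field_simps)
  then have "(2 * l - (a + d))\<^sup>2 = (a - d)\<^sup>2 + 4 * b * c" by simp
  moreover have "4 * ((l - a) * (l - d)) = (2 * l - (a + d))\<^sup>2 - (a - d)\<^sup>2"
    by (simp add: power2_eq_square algebra_simps)
  ultimately have char: "(l - a) * (l - d) = b * c" by simp
  have "\<exists>v m. v \<noteq> 0 \<and> A *v v = m *s v"
  \<comment> \<open>The eigenvector \<open>(b, l - a)\<close> could vanish when
    \<open>b = 0\<close>; the matrix is then lower triangular and \<open>(0, 1)\<close> is an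
    eigenvector.\<close>
  proof (cases "b = 0")
    case True
    have "A *v vector [0, 1] = d *s vector [0, 1]"
      by (simp add: Av vec_eq_iff forall_2 True)
    moreover have "(vector [0, 1] :: complex ^ 2) \<noteq> 0" by (simp add: vec_eq_iff forall_2)
    ultimately show ?thesis by blast
  next
    case False
    have "A *v vector [b, l - a] = l *s vector [b, l - a]"
      using char by (simp add: Av vec_eq_iff forall_2 algebra_simps)
    moreover have "(vector [b, l - a] :: complex ^ 2) \<noteq> 0" using False by (simp add: vec_eq_iff forall_2)
    ultimately show ?thesis by blast
  qed
  then obtain v m where v: "v \<noteq> 0" "A *v v = m *s v" by blast
  then have "m \<noteq> 0" using invertible_mult_vec_nonzero[OF A(1) v(1)] by auto
  then have "vec.span {A *v v} = vec.span {v}"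
    using span_singleton_eq_iff[of v "A *v v"] v invertible_mult_vec_nonzero[OF A(1) v(1)] by auto
  then show ?thesis
    by (intro that[of "vec.span {v}"]) (simp_all add: span_in_proj_line v(1) A(2) homography_coset)
qed

text \<open>
  The point \<open>u\<close> goes to infinity: with \<open>w = (- cnj u\<^sub>2, cnj u\<^sub>1)\<close>, which completes \<open>u\<close> to a basis,
  the line through \<open>\<alpha> u + \<beta> w\<close> has coordinate \<open>\<alpha> / \<beta>\<close>.
\<close>

locale projective_chart =
  fixes u :: "complex ^ 2"
  assumes u_nonzero: "u \<noteq> 0"
begin

definition infty :: line where
  "infty = vec.span {u}"

text \<open>The determinant of \<open>u\<close> and \<open>v\<close>. On
  \<open>\<alpha> u + \<beta> w\<close> it equals \<open>\<beta> * norm2\<close>.\<close>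

definition wedge :: "complex ^ 2 \<Rightarrow> complex" where
  "wedge v = u$1 * v$2 - u$2 * v$1"

text \<open>The numerator is the Hermitian product with \<open>u\<close>, to which \<open>w\<close>
  is orthogonal. On \<open>\<alpha> u + \<beta> w\<close> it equals \<open>\<alpha> * norm2\<close>,
  so the quotient is \<open>\<alpha> / \<beta>\<close>.\<close>

definition slope :: "complex ^ 2 \<Rightarrow> complex" where
  "slope v = (cnj (u$1) * v$1 + cnj (u$2) * v$2) / wedge v"

text \<open>The vector \<open>t u + w\<close>, normalised by the coefficient 1 of
  \<open>w\<close>.\<close>

definition point :: "complex \<Rightarrow> complex ^ 2" where
  "point t = vector [t * u$1 - cnj (u$2), t * u$2 + cnj (u$1)]"

text \<open>The choice of a spanning vector is harmless because \<open>slope\<close> is homogeneous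
  of degree zero. At \<open>infty\<close> the division by zero gives the value 0.\<close>

definition chart :: "line \<Rightarrow> complex" where
  "chart p = slope (SOME v. v \<noteq> 0 \<and> p = vec.span {v})"

definition unchart :: "complex \<Rightarrow> line" where
  "unchart t = vec.span {point t}"

definition norm2 :: complex where
  "norm2 = u$1 * cnj (u$1) + u$2 * cnj (u$2)"

lemma norm2_nonzero: "norm2 \<noteq> 0"
proof
  assume "norm2 = 0"
  then have "complex_of_real ((cmod (u$1))\<^sup>2 + (cmod (u$2))\<^sup>2) = 0"
    by (simp only: norm2_def of_real_add complex_norm_square)
  then have "(cmod (u$1))\<^sup>2 + (cmod (u$2))\<^sup>2 = 0" by (simp only: of_real_eq_0_iff)
  then show False using u_nonzero by (simp add: sum_power2_eq_zero_iff vec_eq_iff forall_2)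
qed

lemma wedge_point: "wedge (point t) = norm2"
  by (simp add: wedge_def point_def norm2_def algebra_simps)

lemma point_nonzero: "point t \<noteq> 0"
  using wedge_point[of t] norm2_nonzero by (auto simp: wedge_def)

lemma slope_point: "slope (point t) = t"
proof -
  have "cnj (u$1) * point t $ 1 + cnj (u$2) * point t $ 2 = t * norm2"
    by (simp add: point_def norm2_def algebra_simps)
  then show ?thesis using norm2_nonzero by (simp add: slope_def wedge_point)
qed

lemma wedge_scale: "wedge (k *s v) = k * wedge v"
  by (simp add: wedge_def algebra_simps)

lemma slope_scale: "k \<noteq> 0 \<Longrightarrow> slope (k *s v) = slope v"
proof -
  assume "k \<noteq> 0"
  have "slope (k *s v) = (k * (cnj (u$1) * v$1 + cnj (u$2) * v$2)) / (k * wedge v)"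
    by (simp add: slope_def wedge_scale algebra_simps)
  then show ?thesis using \<open>k \<noteq> 0\<close> by (simp add: slope_def)
qed

lemma point_slope:
  assumes "wedge v \<noteq> 0"
  shows "point (slope v) = (norm2 / wedge v) *s v"
proof -
  have "wedge v * (slope v * u$1 - cnj (u$2)) = norm2 * v$1"
    "wedge v * (slope v * u$2 + cnj (u$1)) = norm2 * v$2"
    using assms by (simp_all add: slope_def right_diff_distrib distrib_left)
      (simp_all add: wedge_def norm2_def algebra_simps)
  then show ?thesis using assms by (simp add: point_def vec_eq_iff forall_2 field_simps)
qed

lemma chart_span: "v \<noteq> 0 \<Longrightarrow> chart (vec.span {v}) = slope v"
proof -
  assume v: "v \<noteq> 0"
  define w where "w = (SOME w. w \<noteq> 0 \<and> vec.span {v} = vec.span {w})"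
  have w: "w \<noteq> 0 \<and> vec.span {v} = vec.span {w}"
    unfolding w_def by (rule someI[of _ v]) (simp add: v)
  then obtain k where "k \<noteq> 0" "w = k *s v" using span_singleton_eq_iff[of v w] v by blast
  then show ?thesis using slope_scale by (simp add: chart_def w_def[symmetric])
qed

lemma wedge_zero_iff:
  assumes "v \<noteq> 0"
  shows "wedge v = 0 \<longleftrightarrow> vec.span {v} = infty"
proof
  assume "vec.span {v} = infty"
  then obtain k where "v = k *s u"
    using span_singleton_eq_iff[OF u_nonzero assms] by (auto simp: infty_def)
  then show "wedge v = 0" by (simp add: wedge_def)
next
  assume 0: "wedge v = 0"
  define k where "k = (cnj (u$1) * v$1 + cnj (u$2) * v$2) / norm2"
  \<comment> \<open>The expansion of \<open>norm2 * v\<close> in the orthogonal basis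
    \<open>u\<close>, \<open>w\<close>; the coefficient of \<open>w\<close> is
    \<open>wedge v\<close>, so only a multiple of \<open>u\<close> remains.\<close>
  have "norm2 * v$1 = (cnj (u$1) * v$1 + cnj (u$2) * v$2) * u$1 - cnj (u$2) * wedge v"
    "norm2 * v$2 = (cnj (u$1) * v$1 + cnj (u$2) * v$2) * u$2 + cnj (u$1) * wedge v"
    by (simp_all add: norm2_def wedge_def algebra_simps)
  then have v: "v = k *s u"
    using norm2_nonzero 0 by (simp add: k_def vec_eq_iff forall_2 field_simps)
  then have "k \<noteq> 0" using assms by auto
  then have "vec.span {u} = vec.span {v}" using v span_singleton_eq_iff[OF u_nonzero assms] by blast
  then show "vec.span {v} = infty" by (simp add: infty_def)
qed

lemma unchart_proj_line: "unchart t \<in> topspace proj_line - {infty}"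
  using point_nonzero wedge_point norm2_nonzero wedge_zero_iff[OF point_nonzero]
  by (simp add: unchart_def span_in_proj_line)

lemma chart_unchart: "chart (unchart t) = t"
  by (simp add: unchart_def chart_span point_nonzero slope_point)

lemma unchart_chart:
  assumes "p \<in> topspace proj_line - {infty}"
  shows "unchart (chart p) = p"
proof -
  obtain v where v: "v \<noteq> 0" "p = vec.span {v}" using assms proj_lineE by blast
  then have w: "wedge v \<noteq> 0" using assms wedge_zero_iff by blast
  have "vec.span {v} = vec.span {point (slope v)}"
    using span_singleton_eq_iff[OF v(1) point_nonzero] point_slope[OF w] norm2_nonzero w
    by (metis divide_eq_0_iff)
  then show ?thesis unfolding v(2) unchart_def chart_span[OF v(1)] by (rule sym)
qed

lemma continuous_map_unchart: "continuous_map euclidean proj_line unchart"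
proof -
  have "point = (\<lambda>t. \<chi> i. if i = 1 then t * u$1 - cnj (u$2) else t * u$2 + cnj (u$1))"
    by (simp add: fun_eq_iff vec_eq_iff forall_2 point_def)
  moreover have "continuous_on UNIV (\<lambda>t. if i = 1 then t * u$1 - cnj (u$2) else t * u$2 + cnj (u$1))" for i :: 2
    by (cases "i = 1") (auto intro!: continuous_intros)
  ultimately have "continuous_on UNIV point"
    by (simp only: continuous_on_vec_lambda)
  then have "continuous_map euclidean (top_of_set (UNIV - {0})) point"
    using point_nonzero by (simp add: continuous_map_in_subtopology)
  from continuous_map_compose[OF this quotient_imp_continuous_map[OF quotient_map_proj_line]]
  show ?thesis by (simp add: o_def unchart_def[abs_def])
qed

text \<open>Continuity is checked on vectors, where \<open>slope\<close> is a quotient of continuous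
  functions. This is legitimate because the complement of \<open>infty\<close> is open, so the
  quotient map restricts to a quotient map over it.\<close>

lemma continuous_map_chart:
  "continuous_map (subtopology proj_line (topspace proj_line - {infty})) euclidean chart"
proof -
  define V where "V = topspace proj_line - {infty}"
  have pre: "{v \<in> topspace (top_of_set (UNIV - {0})). vec.span {v} \<in> V} = {v. wedge v \<noteq> 0}"
  proof -
    have "v \<noteq> 0 \<and> vec.span {v} \<in> V \<longleftrightarrow> wedge v \<noteq> 0" for v
    proof (cases "v = 0")
      case True
      then show ?thesis by (simp add: wedge_def)
    next
      case False
      then show ?thesis using wedge_zero_iff[OF False] by (simp add: V_def span_in_proj_line)
    qed
    then show ?thesis by simp
  qed
  have wedge: "continuous_on UNIV wedge"
    unfolding wedge_def[abs_def] by (intro continuous_intros)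
  have open_wedge: "open {v. wedge v \<noteq> 0}"
    using open_Collect_neq[OF wedge continuous_on_const[of _ 0]] .
  have "openin (top_of_set (UNIV - {0})) {v. wedge v \<noteq> 0}"
    by (rule open_subset[OF _ open_wedge]) (auto simp: wedge_def)
  then have "openin proj_line V"
    using quotient_map_proj_line pre unfolding quotient_map_def by (auto simp: V_def)
  from quotient_map_restriction[OF quotient_map_proj_line pre] this
  have quot: "quotient_map (subtopology (top_of_set (UNIV - {0})) {v. wedge v \<noteq> 0}) (subtopology proj_line V)
      (\<lambda>v. vec.span {v})" by blast
  have "continuous_on {v. wedge v \<noteq> 0} slope"
    unfolding slope_def[abs_def]
    by (intro continuous_intros continuous_on_subset[OF wedge]) auto
  then have "continuous_on ((UNIV - {0}) \<inter> {v. wedge v \<noteq> 0}) (chart \<circ> (\<lambda>v. vec.span {v}))"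
    by (rule continuous_on_eq[OF continuous_on_subset]) (auto simp: chart_span)
  then have "continuous_map (subtopology (top_of_set (UNIV - {0})) {v. wedge v \<noteq> 0}) euclidean
      (chart \<circ> (\<lambda>v. vec.span {v}))"
    by (simp add: subtopology_subtopology)
  from continuous_compose_quotient_map[OF quot this] show ?thesis by (simp add: V_def)
qed

end

section \<open>Reduction of the projective statement to a planar action\<close>

theorem proposition5p1:
  fixes G :: "mat2 set set" and Z :: "line set" and n :: nat
  assumes "subgroup G PGL2" and "finite G"
    and "Z \<subseteq> topspace proj_line" and "finite Z"
    and "\<And>g. g \<in> G \<Longrightarrow> homography g ` Z \<subseteq> Z"
    and "\<And>p g. p \<in> topspace proj_line \<Longrightarrow> g \<in> G \<Longrightarrow> g \<noteq> \<one>\<^bsub>PGL2\<^esub> \<Longrightarrow> homography g p = p \<Longrightarrow> p \<in> Z"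
    and "(G, Z) \<noteq> ({\<one>\<^bsub>PGL2\<^esub>}, {})"
    and "n \<ge> 1"
  shows "aspherical_space (orbit_config G Z n)"
proof -
  interpret PGL: group PGL2 by (rule group_PGL2)
  interpret G: subgroup G PGL2 by fact
  note finite_G = assms(2) and Z_sub = assms(3) and finite_Z = assms(4) and Z_stable = assms(5)
    and fixed = assms(6)
  have G_carrier: "g \<in> carrier PGL2" if "g \<in> G" for g using that by (rule G.mem_carrier)
  have cancel: "homography (inv\<^bsub>PGL2\<^esub> g) (homography g p) = p" if "g \<in> G" "p \<in> topspace proj_line" for g p
    using homography_mult[OF _ G_carrier[OF that(1)] that(2), of "inv\<^bsub>PGL2\<^esub> g"]
      homography_one[OF that(2)] G_carrier[OF that(1)] by simp
  have closed: "homography g p \<in> topspace proj_line - Z" if "g \<in> G" "p \<in> topspace proj_line - Z" for g p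
  proof -
    have "homography g p \<notin> Z"
    proof
      assume "homography g p \<in> Z"
      then have "homography (inv\<^bsub>PGL2\<^esub> g) (homography g p) \<in> Z"
        using Z_stable[OF G.m_inv_closed[OF that(1)]] by blast
      then show False using cancel[OF that(1)] that(2) by simp
    qed
    then show ?thesis using homography_closed[OF G_carrier[OF that(1)]] that(2) by blast
  qed
  \<comment> \<open>The source of the witness for \<open>act_orbit\<close>, and of the element whose
    triviality gives \<open>act_free\<close>.\<close>
  have quotient: "p = homography (inv\<^bsub>PGL2\<^esub> g \<otimes>\<^bsub>PGL2\<^esub> h) p'"
    if "g \<in> G" "h \<in> G" "p \<in> topspace proj_line" "p' \<in> topspace proj_line"
      "homography g p = homography h p'" for g h p p'
    using cancel[OF that(1,3)] that(5) homography_mult[OF _ G_carrier[OF that(2)] that(4), of "inv\<^bsub>PGL2\<^esub> g"]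
      G_carrier[OF that(1)] by simp
  have "Z \<noteq> {}"
  proof
    assume "Z = {}"
    then obtain g where g: "g \<in> G" "g \<noteq> \<one>\<^bsub>PGL2\<^esub>" using assms(7) G.one_closed by blast
    obtain p where "p \<in> topspace proj_line" "homography g p = p"
      by (rule homography_fixed_point[OF G_carrier[OF g(1)]])
    then show False using fixed[OF _ g] \<open>Z = {}\<close> by blast
  qed
  then obtain u where u: "u \<noteq> 0" "vec.span {u} \<in> Z"
    using Z_sub proj_lineE by blast
  interpret projective_chart u by unfold_locales (rule u(1))
  have infty: "infty \<in> Z" using u(2) by (simp add: infty_def)
  \<comment> \<open>With infinity placed inside \<open>Z\<close>, the chart is defined at every
    point that a configuration can use.\<close>
  have finite_part: "p \<in> topspace proj_line - {infty}" if "p \<in> topspace proj_line - Z" for p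
    using that infty by auto
  define A where "A = chart ` (Z - {infty})"
  define act where "act g t = chart (homography g (unchart t))" for g t
  have un: "unchart t \<in> topspace proj_line" "unchart t \<noteq> infty" for t
    using unchart_proj_line by auto
  have A_iff: "t \<in> A \<longleftrightarrow> unchart t \<in> Z" for t
  proof
    assume "t \<in> A"
    then obtain p where p: "p \<in> Z - {infty}" "t = chart p" unfolding A_def by blast
    then have "unchart t = p" using unchart_chart Z_sub by blast
    then show "unchart t \<in> Z" using p by blast
  next
    assume "unchart t \<in> Z"
    then have "chart (unchart t) \<in> A" unfolding A_def using un(2) by blast
    then show "t \<in> A" by (simp only: chart_unchart)
  qed
  have chart_A: "chart p \<notin> A" if "p \<in> topspace proj_line - Z" for p
  proof -
    have "unchart (chart p) = p" by (rule unchart_chart[OF finite_part[OF that]])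
    then show ?thesis using that A_iff by simp
  qed
  have un_Z: "unchart t \<in> topspace proj_line - Z" if "t \<notin> A" for t
    using that un(1)[of t] by (simp add: A_iff)
  have un_act: "unchart (act g t) = homography g (unchart t)" if "g \<in> G" "t \<notin> A" for g t
    unfolding act_def by (rule unchart_chart[OF finite_part[OF closed[OF that(1) un_Z[OF that(2)]]]])
  have hom_inj: "unchart t = unchart s \<Longrightarrow> t = s" for t s
    using chart_unchart by metis
  interpret plane_action A G act
  proof
    show "finite A" unfolding A_def using finite_Z by simp
    show "finite G" by fact
  next
    fix g assume g: "g \<in> G"
    have "continuous_map (top_of_set (- A)) proj_line unchart"
      using continuous_map_unchart by (rule continuous_map_from_subtopology)
    from continuous_map_compose[OF this continuous_map_homography[OF G_carrier[OF g]]]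
    have "continuous_map (top_of_set (- A)) (subtopology proj_line (topspace proj_line - {infty}))
        (\<lambda>t. homography g (unchart t))"
      using finite_part[OF closed[OF g un_Z]] by (auto simp: continuous_map_in_subtopology o_def)
    from continuous_map_compose[OF this continuous_map_chart]
    show "continuous_on (- A) (act g)" by (simp add: o_def act_def[abs_def])
  next
    fix g t assume "g \<in> G" "t \<notin> A"
    then show "act g t \<notin> A"
      unfolding act_def by (intro chart_A closed un_Z)
  next
    fix g h t assume gh: "g \<in> G" "h \<in> G" and t: "t \<notin> A" and "act g t = act h t"
    then have "homography g (unchart t) = homography h (unchart t)"
      using un_act[OF gh(1) t] un_act[OF gh(2) t] by simp
    then have eq: "unchart t = homography (inv\<^bsub>PGL2\<^esub> g \<otimes>\<^bsub>PGL2\<^esub> h) (unchart t)"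
      by (rule quotient[OF gh un(1) un(1)])
    \<comment> \<open>This element fixes a point outside \<open>Z\<close>, and \<open>Z\<close>
      contains all fixed points of nontrivial elements of \<open>G\<close>.\<close>
    have "inv\<^bsub>PGL2\<^esub> g \<otimes>\<^bsub>PGL2\<^esub> h = \<one>\<^bsub>PGL2\<^esub>"
    proof (rule ccontr)
      assume "inv\<^bsub>PGL2\<^esub> g \<otimes>\<^bsub>PGL2\<^esub> h \<noteq> \<one>\<^bsub>PGL2\<^esub>"
      then have "unchart t \<in> Z"
        using fixed[OF un(1)[of t], of "inv\<^bsub>PGL2\<^esub> g \<otimes>\<^bsub>PGL2\<^esub> h"] eq gh by simp
      then show False using t A_iff by blast
    qed
    then have "inv\<^bsub>PGL2\<^esub> (inv\<^bsub>PGL2\<^esub> g) = h"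
      using PGL.inv_equality[of h "inv\<^bsub>PGL2\<^esub> g"] gh G_carrier PGL.inv_comm PGL.inv_closed by metis
    then show "g = h" using G_carrier[OF gh(1)] by simp
  next
    fix g h t s assume gh: "g \<in> G" "h \<in> G" and ts: "t \<notin> A" "s \<notin> A" and "act g t = act h s"
    then have "homography g (unchart t) = homography h (unchart s)"
      using un_act[OF gh(1) ts(1)] un_act[OF gh(2) ts(2)] by simp
    then have eq: "unchart t = homography (inv\<^bsub>PGL2\<^esub> g \<otimes>\<^bsub>PGL2\<^esub> h) (unchart s)"
      by (rule quotient[OF gh un(1) un(1)])
    have k: "inv\<^bsub>PGL2\<^esub> g \<otimes>\<^bsub>PGL2\<^esub> h \<in> G" using gh by simp
    have "t = act (inv\<^bsub>PGL2\<^esub> g \<otimes>\<^bsub>PGL2\<^esub> h) s"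
      by (rule hom_inj) (simp only: un_act[OF k ts(2)] eq[symmetric])
    with k show "\<exists>k\<in>G. t = act k s" by blast
  next
    show "\<exists>e\<in>G. \<forall>t. t \<notin> A \<longrightarrow> act e t = t"
      using G.one_closed homography_one[OF un(1)] chart_unchart by (intro bexI[of _ "\<one>\<^bsub>PGL2\<^esub>"]) (simp_all add: act_def)
  qed
  let ?W = "subtopology proj_line (topspace proj_line - Z)"
  have top: "p \<in> topspace (orbit_config G Z n) \<longleftrightarrow> p \<in> {1..n} \<rightarrow>\<^sub>E topspace proj_line - Z \<and>
      (\<forall>i\<in>{1..n}. \<forall>j\<in>{1..n}. i \<noteq> j \<longrightarrow> (\<forall>g\<in>G. p i \<noteq> homography g (p j)))" for p
    unfolding orbit_config_def topspace_subtopology topspace_product_topology by auto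
  have to_config: "(\<lambda>i\<in>{1..n}. chart (p i)) \<in> config n" if p: "p \<in> topspace (orbit_config G Z n)" for p
  proof -
    have pZ: "p i \<in> topspace proj_line - Z" if "i \<in> {1..n}" for i using p that unfolding top by blast
    have un_p: "unchart (chart (p i)) = p i" if "i \<in> {1..n}" for i
      by (rule unchart_chart[OF finite_part[OF pZ[OF that]]])
    have "chart (p i) \<noteq> act g (chart (p j))" if "i \<in> {1..n}" "j \<in> {1..n}" "i \<noteq> j" "g \<in> G" for i j g
    proof
      assume "chart (p i) = act g (chart (p j))"
      then have "unchart (chart (p i)) = homography g (unchart (chart (p j)))"
        using un_act[OF that(4) chart_A[OF pZ[OF that(2)]]] by simp
      then show False using p that unfolding un_p[OF that(1)] un_p[OF that(2)] top by blast
    qed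
    then show ?thesis using chart_A[OF pZ] unfolding config_def by auto
  qed
  have from_config: "(\<lambda>i\<in>{1..n}. unchart (w i)) \<in> topspace (orbit_config G Z n)" if w: "w \<in> config n" for w
  proof -
    have "unchart (w i) \<in> topspace proj_line - Z" if "i \<in> {1..n}" for i
      by (rule un_Z[OF config_notin[OF w that]])
    moreover have "unchart (w i) \<noteq> homography g (unchart (w j))"
      if "i \<in> {1..n}" "j \<in> {1..n}" "i \<noteq> j" "g \<in> G" for i j g
    proof
      assume "unchart (w i) = homography g (unchart (w j))"
      then have "unchart (w i) = unchart (act g (w j))"
        using un_act[OF that(4) config_notin[OF w that(2)]] by simp
      from hom_inj[OF this] config_neq[OF w that] show False by simp
    qed
    ultimately show ?thesis unfolding top by auto
  qed
  \<comment> \<open>The chart is applied to each coordinate; restricting to \<open>{1..n}\<close>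
    keeps the functions extensional, so the two maps are inverse to each other as functions on all
    indices.\<close>
  have "homeomorphic_maps (orbit_config G Z n) (config_space n)
      (\<lambda>p. \<lambda>i\<in>{1..n}. chart (p i)) (\<lambda>w. \<lambda>i\<in>{1..n}. unchart (w i))"
    unfolding homeomorphic_maps_def
  proof (intro conjI ballI)
    show "continuous_map (orbit_config G Z n) (config_space n) (\<lambda>p. \<lambda>i\<in>{1..n}. chart (p i))"
      unfolding continuous_map_config_space
    proof (intro conjI ballI)
      show "(\<lambda>i\<in>{1..n}. chart (p i)) \<in> config n" if "p \<in> topspace (orbit_config G Z n)" for p
        by (rule to_config[OF that])
      fix i assume i: "i \<in> {1..n}"
      have "continuous_map (orbit_config G Z n) ?W (\<lambda>p. p i)"
        unfolding orbit_config_def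
        by (rule continuous_map_from_subtopology[OF continuous_map_product_projection[OF i]])
      moreover have "continuous_map ?W euclidean chart"
        by (rule continuous_map_from_subtopology_mono[OF continuous_map_chart]) (use finite_part in blast)
      ultimately have "continuous_map (orbit_config G Z n) euclidean (chart \<circ> (\<lambda>p. p i))"
        by (rule continuous_map_compose)
      then show "continuous_map (orbit_config G Z n) euclidean (\<lambda>p. (\<lambda>i\<in>{1..n}. chart (p i)) i)"
        using i by (simp add: o_def)
    qed
    have "continuous_map (config_space n) (product_topology (\<lambda>_. ?W) {1..n}) (\<lambda>w. \<lambda>i\<in>{1..n}. unchart (w i))"
      unfolding continuous_map_componentwise
    proof (intro conjI ballI)
      fix i assume i: "i \<in> {1..n}"
      have "continuous_map (config_space n) euclidean (\<lambda>w. w i)"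
        using continuous_map_config_space[of "config_space n" n "\<lambda>w. w"] i by (simp add: topspace_config_space flip: id_def)
      from continuous_map_compose[OF this continuous_map_unchart]
      have "continuous_map (config_space n) proj_line (\<lambda>w. unchart (w i))" by (simp add: o_def)
      moreover have "unchart (w i) \<in> topspace proj_line - Z" if "w \<in> config n" for w
        by (rule un_Z[OF config_notin[OF that i]])
      ultimately show "continuous_map (config_space n) ?W (\<lambda>w. (\<lambda>i\<in>{1..n}. unchart (w i)) i)"
        using i by (auto simp: continuous_map_in_subtopology topspace_config_space)
    qed auto
    moreover have "(\<lambda>w. \<lambda>i\<in>{1..n}. unchart (w i)) ` config n \<subseteq>
        {p. \<forall>i\<in>{1..n}. \<forall>j\<in>{1..n}. i \<noteq> j \<longrightarrow> (\<forall>g\<in>G. p i \<noteq> homography g (p j))}"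
      using from_config unfolding top by blast
    ultimately show "continuous_map (config_space n) (orbit_config G Z n) (\<lambda>w. \<lambda>i\<in>{1..n}. unchart (w i))"
      unfolding orbit_config_def by (intro continuous_map_into_subtopology) (auto simp: topspace_config_space)
  next
    fix p assume p: "p \<in> topspace (orbit_config G Z n)"
    have "unchart (chart (p i)) = p i" if "i \<in> {1..n}" for i
    proof (rule unchart_chart[OF finite_part])
      show "p i \<in> topspace proj_line - Z" using p that unfolding top by blast
    qed
    moreover have "p \<in> extensional {1..n}" using p unfolding top PiE_def by blast
    ultimately show "(\<lambda>i\<in>{1..n}. unchart ((\<lambda>i\<in>{1..n}. chart (p i)) i)) = p"
      by (auto simp: fun_eq_iff extensional_def)
  next
    fix w assume "w \<in> topspace (config_space n)"
    then have "w \<in> extensional {1..n}"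
      using config_extensional by (simp add: topspace_config_space)
    then show "(\<lambda>i\<in>{1..n}. chart ((\<lambda>i\<in>{1..n}. unchart (w i)) i)) = w"
      by (auto simp: fun_eq_iff extensional_def chart_unchart)
  qed
  then show ?thesis by (rule aspherical_if_homeomorphic_config_space)
qed

end
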